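(* Let $\varphi=\frac{1+\sqrt5}{2}$. Then $S_{\mathrm{bd}}(2)=S(2)=1$ and $S_{\mathrm{bd}}(3)=S(3)=\sqrt{\varphi}$. Furthermore, let $n\in\{2,3\}$ and let $\mathcal{F}$ be a family of $n$ unit squares covering the boundary of a square $S$ of edge length $S_{\mathrm{bd}}(n)$. Then the following holds. - If $n=2$, then at least one element of $\mathcal{F}$ is a translate of $S$. - If $n=3$, then the elements of $\mathcal{F}$, together with $S$, form a configuration congruent to the following one: with $s=\sqrt{\varphi}$ and $\alpha=\arccos\frac{1}{\sqrt{\varphi}}$, the covered square is $[0,s]^2$ and the three unit squares are $[s-1,s]^2$ and the two images of $[0,1]^2$ under the rotations about the origin by the angles $+\alpha$ and $-\alpha$. That is, there is an isometry of $\mathbb{R}^2$ mapping $S$ to $[0,s]^2$ and mapping $\mathcal{F}$ to the family consisting of these three unit squares.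
   Context: All squares are closed (solid) squares in the Euclidean plane $\mathbb{R}^2$, arbitrarily positioned and oriented; a unit square is a square of edge length $1$. A family of sets covers a set $X$ if $X$ is contained in the union of the family. For a positive integer $n$, $S(n)$ denotes the largest value such that a square of edge length $S(n)$ can be covered by $n$ unit squares. For an integer $n\ge 2$, $S_{\mathrm{bd}}(n)$ denotes the largest value such that the boundary of a square of edge length $S_{\mathrm{bd}}(n)$ can be covered by $n$ unit squares. *)

theory Defs
  imports "HOL-Analysis.Analysis"
begin

definition is_square :: "real \<Rightarrow> (real^2) set \<Rightarrow> bool" where
  "is_square l S \<longleftrightarrow> 0 < l \<and>
     (\<exists>p u v. norm u = 1 \<and> norm v = 1 \<and> u \<bullet> v = 0 \<and>
        S = {p + a *\<^sub>R u + b *\<^sub>R v | a b. 0 \<le> a \<and> a \<le> l \<and> 0 \<le> b \<and> b \<le> l})"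

text \<open>A family of \<open>n\<close> unit squares is indexed by \<open>{..<n}\<close>; repetitions are allowed.\<close>

definition unit_square_cover :: "nat \<Rightarrow> (nat \<Rightarrow> (real^2) set) \<Rightarrow> (real^2) set \<Rightarrow> bool" where
  "unit_square_cover n Q X \<longleftrightarrow> (\<forall>i<n. is_square 1 (Q i)) \<and> X \<subseteq> (\<Union>i<n. Q i)"

definition coverable :: "nat \<Rightarrow> real \<Rightarrow> bool" where
  "coverable n l \<longleftrightarrow> (\<exists>S Q. is_square l S \<and> unit_square_cover n Q S)"

definition bd_coverable :: "nat \<Rightarrow> real \<Rightarrow> bool" where
  "bd_coverable n l \<longleftrightarrow> (\<exists>S Q. is_square l S \<and> unit_square_cover n Q (frontier S))"

definition is_largest :: "(real \<Rightarrow> bool) \<Rightarrow> real \<Rightarrow> bool" where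
  "is_largest P x \<longleftrightarrow> P x \<and> (\<forall>y. P y \<longrightarrow> y \<le> x)"

text \<open>\<open>Greatest\<close> is unspecified when there is no largest value; \<open>is_largest\<close> is used to
  state separately that the values below are attained maxima.\<close>

definition S_full :: "nat \<Rightarrow> real" where
  "S_full n = (GREATEST l. coverable n l)"

definition S_bd :: "nat \<Rightarrow> real" where
  "S_bd n = (GREATEST l. bd_coverable n l)"

definition phi :: real where
  "phi = (1 + sqrt 5) / 2"

text \<open>The axis-parallel square \<open>[a,b]\<^sup>2\<close>.\<close>

definition axis_square :: "real \<Rightarrow> real \<Rightarrow> (real^2) set" where
  "axis_square a b = cbox (vec a) (vec b)"

text \<open>Counterclockwise rotation about the origin.\<close>

definition rot :: "real \<Rightarrow> real^2 \<Rightarrow> real^2" where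
  "rot t x = vector [cos t * x$1 - sin t * x$2, sin t * x$1 + cos t * x$2]"

text \<open>Distance-preserving self-maps of the plane are automatically bijective.\<close>

definition plane_isometry :: "(real^2 \<Rightarrow> real^2) \<Rightarrow> bool" where
  "plane_isometry f \<longleftrightarrow> (\<forall>x y. dist (f x) (f y) = dist x y)"

definition is_translate :: "(real^2) set \<Rightarrow> (real^2) set \<Rightarrow> bool" where
  "is_translate A B \<longleftrightarrow> (\<exists>c. A = (+) c ` B)"

end

theory Submission
  imports Defs
begin

text \<open>
  Only the upper bounds and the rigidity need an idea: a unit square is a cover of itself, and the
  three squares of the golden configuration are seen to cover \<open>[0,\<sigma>]\<^sup>2\<close>, where
  \<open>\<sigma> = sqrt phi\<close>, by comparing a point with the edges that bound them.

  Let the boundary of \<open>[0,l]\<^sup>2\<close> be covered. A unit square has diameter \<open>sqrt 2\<close>, so for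
  \<open>l > 1\<close> none contains opposite corners, and the four corners are shared out so that some square
  holds two adjacent ones. Where two of the closed squares together cover a segment of a side, each
  holding one end of it, connectedness gives them a common point on it. Everything then depends on
  how far a tilted unit square that holds certain boundary points can reach, which is read off from
  its extent along its own two axes \<open>(c, s)\<close> and \<open>(- s, c)\<close>.

  Two squares. One holds the bottom side and the other the top side, and they meet at heights
  \<open>a\<close> and \<open>b\<close> on the left and right sides. For one of them the two reaches add up to at least
  \<open>l\<close>, and then its extents give \<open>l (1 + s c) \<le> s + c \<le> 1 + s c\<close>, with equality
  only for an untilted square (\<open>unit_square_with_trapezoid\<close>).

  Three squares, \<open>l \<ge> \<sigma>\<close>. Let \<open>X\<close> hold the bottom side. It reaches at most \<open>\<sigma> - 1\<close> up
  the left and right sides and does not meet the top. If another square held both top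
  corners, the third would have to cover most of both the left and the right side, which is too
  much for its diameter. So \<open>Y\<close> holds the upper right and \<open>Z\<close> the upper left corner; \<open>X\<close> meets
  \<open>Z\<close> at height \<open>a\<close> on the left side, \<open>X\<close> meets \<open>Y\<close> at height \<open>b\<close> on the right side, and
  \<open>Y\<close> meets \<open>Z\<close> at abscissa \<open>m\<close> on the top. Thus \<open>Y\<close> contains a right angle with legs
  \<open>l - b\<close> and \<open>l - m\<close>, and \<open>Z\<close> one with legs \<open>l - a\<close> and \<open>m\<close>. A unit square containing a
  leg \<open>P \<ge> 1\<close> allows a second leg of length at most \<open>P - P sqrt (P\<^sup>2 - 1)\<close>
  (\<open>leg_bound\<close>); this drops from \<open>1\<close> to \<open>\<sigma> - 1\<close> as \<open>P\<close> grows from \<open>1\<close> to \<open>\<sigma>\<close>,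
  which is where the golden ratio enters. By a reflection let \<open>a \<le> b\<close>. With
  \<open>d = \<sigma> - 1 - b\<close>, straight lines above this curve and above the region of feasible
  \<open>(a, b)\<close> yield
  \<open>m \<le> \<sigma> - 1 + 2 a\<close>, \<open>l - m \<le> 1 - 13/5 d\<close> and \<open>4 a \<le> 5 d\<close>
  (\<open>leg_long\<close>, \<open>leg_short\<close>, \<open>base_bound\<close>). Their sum is \<open>l \<le> \<sigma> - d / 10\<close>.
  Hence \<open>l = \<sigma>\<close> and \<open>d = 0\<close>, so \<open>a\<close>, \<open>b\<close> and \<open>m\<close> are known, all three tilts are
  forced, and with them the three squares (\<open>golden_position\<close>).
\<close>

section \<open>Plane isometries\<close>

lemma plane_isometry_affine:
  assumes "plane_isometry f"
  obtains w T where "orthogonal_transformation T" "f = (\<lambda>x. w + T x)"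
proof
  show "orthogonal_transformation (\<lambda>x. f x - f 0)"
    using assms by (simp add: orthogonal_transformation_isometry plane_isometry_def dist_norm)
  show "f = (\<lambda>x. f 0 + (f x - f 0))" by simp
qed

lemma plane_isometry_compose:
  "plane_isometry f \<Longrightarrow> plane_isometry g \<Longrightarrow> plane_isometry (f \<circ> g)"
  by (simp add: plane_isometry_def)

lemma is_square_isometry_image:
  assumes f: "plane_isometry f" and S: "is_square l S"
  shows "is_square l (f ` S)"
proof -
  obtain w T where T: "orthogonal_transformation T" "f = (\<lambda>x. w + T x)"
    using plane_isometry_affine[OF f] .
  obtain p u v where puv: "norm u = 1" "norm v = 1" "u \<bullet> v = 0" and l: "0 < l"
     and S: "S = {p + a *\<^sub>R u + b *\<^sub>R v | a b. 0 \<le> a \<and> a \<le> l \<and> 0 \<le> b \<and> b \<le> l}"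
    using S by (auto simp: is_square_def)
  have lin: "linear T" using T by (simp add: orthogonal_transformation)
  have img: "f (p + a *\<^sub>R u + b *\<^sub>R v) = f p + a *\<^sub>R T u + b *\<^sub>R T v" for a b
    by (simp add: T(2) linear_add[OF lin] linear_cmul[OF lin])
  have "f ` S = {f p + a *\<^sub>R T u + b *\<^sub>R T v | a b. 0 \<le> a \<and> a \<le> l \<and> 0 \<le> b \<and> b \<le> l}"
    unfolding S image_def by (force simp: img)
  moreover have "norm (T u) = 1" "norm (T v) = 1" "T u \<bullet> T v = 0"
    using T puv by (simp_all add: orthogonal_transformation_norm orthogonal_transformation_def)
  ultimately show ?thesis using l unfolding is_square_def by blast
qed

lemma frontier_isometry_image:
  assumes "plane_isometry f"
  shows "frontier (f ` S) = f ` frontier S"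
proof -
  obtain w T where T: "orthogonal_transformation T" "f = (\<lambda>x. w + T x)"
    using plane_isometry_affine[OF assms] .
  have lin: "linear T" and inj: "inj T"
    using T by (simp_all add: orthogonal_transformation orthogonal_transformation_inj)
  have "frontier (T ` S) = T ` frontier S"
    unfolding frontier_def interior_injective_linear_image[OF lin inj]
      closure_injective_linear_image[OF lin inj, symmetric] image_set_diff[OF inj, symmetric] ..
  then have "frontier ((+) w ` (T ` S)) = (+) w ` (T ` frontier S)" by (simp add: frontier_translation)
  then show ?thesis by (simp add: T(2) image_image)
qed

lemma is_translate_isometry_cancel:
  assumes "plane_isometry f" "is_translate (f ` A) (f ` B)"
  shows "is_translate A B"
proof -
  obtain w T where T: "orthogonal_transformation T" "f = (\<lambda>x. w + T x)"
    using plane_isometry_affine[OF assms(1)] .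
  have lin: "linear T" and inj: "inj T" and surj: "surj T"
    using T by (simp_all add: orthogonal_transformation orthogonal_transformation_inj orthogonal_transformation_surj)
  obtain c where c: "f ` A = (+) c ` f ` B" using assms(2) by (auto simp: is_translate_def)
  obtain d where d: "c = T d" using surj by blast
  have "f ` A = f ` ((+) d ` B)"
    unfolding c by (simp add: image_image T(2) linear_add[OF lin] d algebra_simps)
  moreover have "inj f" using inj by (simp add: T(2) inj_def)
  ultimately show ?thesis unfolding is_translate_def by (metis inj_image_eq_iff)
qed

section \<open>Unit squares as intersections of two strips\<close>

definition pt :: "real \<Rightarrow> real \<Rightarrow> real^2" where "pt x y = vector [x, y]"

lemma pt_nth [simp]: "pt x y $ 1 = x" "pt x y $ 2 = y" by (simp_all add: pt_def)

lemma pt_eta [simp]: "pt (z $ 1) (z $ 2) = z" by (simp add: vec_eq_iff forall_2)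

lemma inner_2: "(x::real^2) \<bullet> y = x$1 * y$1 + x$2 * y$2" by (simp add: inner_vec_def sum_2)

lemma norm_2: "norm (x::real^2) = 1 \<longleftrightarrow> x$1^2 + x$2^2 = 1"
  by (simp add: norm_eq_1 inner_2 power2_eq_square)

lemma mem_axis_square: "z \<in> axis_square a b \<longleftrightarrow> a \<le> z$1 \<and> z$1 \<le> b \<and> a \<le> z$2 \<and> z$2 \<le> b"
  by (auto simp: axis_square_def mem_box_cart forall_2 vec_def)

text \<open>The unit square with edge directions \<open>(c, s)\<close> and \<open>(- s, c)\<close>, when \<open>(c, s)\<close> is a unit
  vector. The offsets \<open>e\<close> and \<open>h\<close> are the coordinates of its lower corner along these directions,
  so containment of a point is a pair of linear inequalities.\<close>

definition strips :: "real \<Rightarrow> real \<Rightarrow> real \<Rightarrow> real \<Rightarrow> (real^2) set" where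
  "strips c s e h = {z. c * z$1 + s * z$2 \<in> {e..e+1} \<and> c * z$2 - s * z$1 \<in> {h..h+1}}"

text \<open>By Lagrange's identity the determinant of an orthonormal pair is \<open>\<plusminus> 1\<close>, which
  determines the second vector from the first up to sign.\<close>

lemma orthonormal_frame_cases:
  fixes u v :: "real^2"
  assumes "norm u = 1" "norm v = 1" "u \<bullet> v = 0"
  obtains "v = pt (- u$2) (u$1)" | "v = pt (u$2) (- u$1)"
proof -
  have u: "u$1^2 + u$2^2 = 1" and v: "v$1^2 + v$2^2 = 1" and o: "u$1 * v$1 + u$2 * v$2 = 0"
    using assms by (simp_all add: norm_2 inner_2)
  define k where "k = u$1 * v$2 - u$2 * v$1"
  have "k^2 + (u$1 * v$1 + u$2 * v$2)^2 = (u$1^2 + u$2^2) * (v$1^2 + v$2^2)"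
    by (simp add: k_def algebra_simps power2_eq_square)
  then have "k^2 = 1" using u v o by simp
  moreover have "v = pt (- k * u$2) (k * u$1)"
  proof -
    have "v$1 = - k * u$2 + u$1 * (u$1 * v$1 + u$2 * v$2) + v$1 * (1 - (u$1^2 + u$2^2))"
      "v$2 = k * u$1 + u$2 * (u$1 * v$1 + u$2 * v$2) + v$2 * (1 - (u$1^2 + u$2^2))"
      by (simp_all add: k_def algebra_simps power2_eq_square)
    then show ?thesis unfolding u o by (simp add: vec_eq_iff forall_2)
  qed
  ultimately show ?thesis using that by (auto simp: power2_eq_1_iff)
qed

lemma orthonormal_expansion:
  fixes u v :: "real^2"
  assumes "norm u = 1" "norm v = 1" "u \<bullet> v = 0"
  shows "z = (z \<bullet> u) *\<^sub>R u + (z \<bullet> v) *\<^sub>R v"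
proof -
  have u: "u$1 * u$1 + u$2 * u$2 = 1" using assms by (simp_all add: norm_2 power2_eq_square)
  have "z$1 = z$1 * (u$1 * u$1 + u$2 * u$2)" "z$2 = z$2 * (u$1 * u$1 + u$2 * u$2)" by (simp_all add: u)
  then show ?thesis
    by (cases rule: orthonormal_frame_cases[OF assms])
      (simp_all add: vec_eq_iff forall_2 inner_2 algebra_simps)
qed

lemma mem_frame_square:
  fixes u v :: "real^2"
  assumes "norm u = 1" "norm v = 1" "u \<bullet> v = 0"
  shows "z \<in> {p + a *\<^sub>R u + b *\<^sub>R v | a b. 0 \<le> a \<and> a \<le> l \<and> 0 \<le> b \<and> b \<le> l} \<longleftrightarrow>
     0 \<le> (z - p) \<bullet> u \<and> (z - p) \<bullet> u \<le> l \<and> 0 \<le> (z - p) \<bullet> v \<and> (z - p) \<bullet> v \<le> l" (is "?L \<longleftrightarrow> ?R")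
proof
  assume ?L
  moreover have "u \<bullet> u = 1" "v \<bullet> v = 1" "v \<bullet> u = 0" using assms by (simp_all add: norm_eq_1 inner_commute)
  ultimately show ?R using assms by (auto simp: inner_simps)
next
  assume ?R
  moreover have "z = p + ((z - p) \<bullet> u) *\<^sub>R u + ((z - p) \<bullet> v) *\<^sub>R v"
    using orthonormal_expansion[OF assms, of "z - p"] by (simp add: algebra_simps)
  ultimately show ?L by blast
qed

lemma strips_quarter_turn: "strips c s e h = strips (- s) c h (- e - 1)"
  by (auto simp: strips_def)

text \<open>Directions of edges matter only modulo quarter turns, and one of the four turns of a unit vector lies
  in the half-open quadrant \<open>c > 0\<close>, \<open>s \<ge> 0\<close>. This normal form is what makes reflections
  unnecessary in the estimates: every tilt is represented once.\<close>

lemma unit_square_strips: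
  assumes "is_square 1 Q"
  obtains c s e h where "0 < c" "0 \<le> s" "c^2 + s^2 = 1" "Q = strips c s e h"
proof -
  obtain p u v where puv: "norm u = 1" "norm v = 1" "u \<bullet> v = 0"
     and Q: "Q = {p + a *\<^sub>R u + b *\<^sub>R v | a b. 0 \<le> a \<and> a \<le> 1 \<and> 0 \<le> b \<and> b \<le> 1}"
    using assms by (auto simp: is_square_def)
  have mem: "z \<in> Q \<longleftrightarrow> 0 \<le> (z - p) \<bullet> u \<and> (z - p) \<bullet> u \<le> 1 \<and> 0 \<le> (z - p) \<bullet> v \<and> (z - p) \<bullet> v \<le> 1" for z
    unfolding Q by (rule mem_frame_square[OF puv])
  define dir where "dir c s \<longleftrightarrow> (\<exists>e h. Q = strips c s e h)" for c s
  have turn: "dir (- s) c" if "dir c s" for c s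
    using that strips_quarter_turn unfolding dir_def by metis
  let ?e = "u$1 * p$1 + u$2 * p$2" and ?h = "u$1 * p$2 - u$2 * p$1"
  have d0: "dir (u$1) (u$2)"
  proof (cases rule: orthonormal_frame_cases[OF puv])
    case 1
    then have "Q = strips (u$1) (u$2) ?e ?h"
      by (auto simp: set_eq_iff mem strips_def inner_2 algebra_simps)
    then show ?thesis unfolding dir_def by blast
  next
    case 2
    then have "Q = strips (u$1) (u$2) ?e (?h - 1)"
      by (auto simp: set_eq_iff mem strips_def inner_2 algebra_simps)
    then show ?thesis unfolding dir_def by blast
  qed
  have d1: "dir (- u$2) (u$1)" using turn[OF d0] .
  have d2: "dir (- u$1) (- u$2)" using turn[OF d1] .
  have d3: "dir (u$2) (- u$1)" using turn[OF d2] by simp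
  have u: "u$1^2 + u$2^2 = 1" "u$2^2 + u$1^2 = 1" using puv by (simp_all add: norm_2)
  then have "u$1 \<noteq> 0 \<or> u$2 \<noteq> 0" by auto
  then consider "u$1 > 0" "u$2 \<ge> 0" | "u$2 > 0" "u$1 \<le> 0" | "u$1 < 0" "u$2 \<le> 0" | "u$2 < 0" "u$1 \<ge> 0"
    by linarith
  then have "\<exists>c s. 0 < c \<and> 0 \<le> s \<and> c^2 + s^2 = 1 \<and> dir c s"
  proof cases
    case 1 then show ?thesis using d0 u by blast
  next
    case 2 then show ?thesis using d3 u by (intro exI[of _ "u$2"] exI[of _ "- u$1"]) simp
  next
    case 3 then show ?thesis using d2 u by (intro exI[of _ "- u$1"] exI[of _ "- u$2"]) simp
  next
    case 4 then show ?thesis using d1 u by (intro exI[of _ "- u$2"] exI[of _ "u$1"]) simp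
  qed
  then show ?thesis using that unfolding dir_def by blast
qed

lemma is_square_axis_square: "a < b \<Longrightarrow> is_square (b - a) (axis_square a b)"
proof -
  assume "a < b"
  have puv: "norm (pt 1 0) = 1" "norm (pt 0 1) = 1" "pt 1 0 \<bullet> pt 0 1 = 0"
    by (simp_all add: norm_2 inner_2)
  have "axis_square a b = {pt a a + x *\<^sub>R pt 1 0 + y *\<^sub>R pt 0 1 | x y. 0 \<le> x \<and> x \<le> b - a \<and> 0 \<le> y \<and> y \<le> b - a}"
    by (rule set_eqI) (unfold mem_frame_square[OF puv], auto simp: inner_2 mem_axis_square)
  moreover have "0 < b - a" using \<open>a < b\<close> by simp
  ultimately show ?thesis unfolding is_square_def using puv by blast
qed

lemma closed_strips: "closed (strips c s e h)"
  unfolding strips_def atLeastAtMost_iff by (intro closed_Collect_conj closed_Collect_le continuous_intros)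

lemma closed_unit_square: "is_square 1 Q \<Longrightarrow> closed Q"
  by (metis unit_square_strips closed_strips)

lemma square_normal_position:
  assumes "is_square l S"
  obtains f where "plane_isometry f" "f ` S = axis_square 0 l"
proof -
  obtain p u v where puv: "norm u = 1" "norm v = 1" "u \<bullet> v = 0"
     and S: "S = {p + a *\<^sub>R u + b *\<^sub>R v | a b. 0 \<le> a \<and> a \<le> l \<and> 0 \<le> b \<and> b \<le> l}"
    using assms by (auto simp: is_square_def)
  define f where "f z = pt ((z - p) \<bullet> u) ((z - p) \<bullet> v)" for z
  have f: "f (p + a *\<^sub>R u + b *\<^sub>R v) = pt a b" for a b
    using puv by (simp add: f_def inner_simps norm_eq_1 inner_commute)
  have "norm (f x - f y) = norm (x - y)" for x y
  proof -
    have "f x - f y = pt ((x - y) \<bullet> u) ((x - y) \<bullet> v)" by (simp add: f_def vec_eq_iff forall_2 inner_simps)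
    then have "(norm (f x - f y))^2 = ((x - y) \<bullet> u)^2 + ((x - y) \<bullet> v)^2"
      by (simp only: power2_norm_eq_inner inner_2) (simp add: power2_eq_square)
    also have "\<dots> = (norm (x - y))^2"
    proof -
      have "(norm (x - y))^2 = (x - y) \<bullet> (((x - y) \<bullet> u) *\<^sub>R u + ((x - y) \<bullet> v) *\<^sub>R v)"
        using orthonormal_expansion[OF puv, of "x - y"] by (simp only: power2_norm_eq_inner)
      then show ?thesis by (simp only: inner_add_right inner_scaleR_right power2_eq_square)
    qed
    finally show ?thesis by simp
  qed
  then have 1: "plane_isometry f" by (simp add: plane_isometry_def dist_norm)
  have "f ` S = axis_square 0 l"
  proof
    show "f ` S \<subseteq> axis_square 0 l" unfolding S by (auto simp: f mem_axis_square)
    show "axis_square 0 l \<subseteq> f ` S"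
    proof
      fix z assume "z \<in> axis_square 0 l"
      then have "p + (z$1) *\<^sub>R u + (z$2) *\<^sub>R v \<in> S" unfolding S by (auto simp: mem_axis_square)
      then have "f (p + (z$1) *\<^sub>R u + (z$2) *\<^sub>R v) \<in> f ` S" by (rule imageI)
      then show "z \<in> f ` S" by (simp only: f pt_eta)
    qed
  qed
  with 1 show ?thesis by (rule that)
qed

section \<open>Common points on the sides of a square\<close>

lemma mem_frontier_axis_square:
  "0 < l \<Longrightarrow> pt x y \<in> frontier (axis_square 0 l) \<longleftrightarrow>
    0 \<le> x \<and> x \<le> l \<and> 0 \<le> y \<and> y \<le> l \<and> (x = 0 \<or> x = l \<or> y = 0 \<or> y = l)"
  by (auto simp: axis_square_def frontier_cbox mem_box_cart forall_2 vec_def)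

text \<open>The only use of topology: a segment is connected, so two closed sets that cover it and each contain
  an endpoint must meet on it.\<close>

lemma common_point_on_line:
  fixes X Y :: "(real^2) set"
  assumes "closed X" "closed Y" "t0 \<le> t1"
    and cov: "\<And>t. t0 \<le> t \<Longrightarrow> t \<le> t1 \<Longrightarrow> p + t *\<^sub>R d \<in> X \<union> Y"
    and ends: "p + t0 *\<^sub>R d \<in> X" "p + t1 *\<^sub>R d \<in> Y"
  obtains t where "t0 \<le> t" "t \<le> t1" "p + t *\<^sub>R d \<in> X" "p + t *\<^sub>R d \<in> Y"
proof -
  let ?I = "(\<lambda>t. p + t *\<^sub>R d) ` {t0..t1}"
  have "connected ?I" by (intro connected_continuous_image continuous_intros) simp
  moreover have "?I \<subseteq> X \<union> Y" by (rule image_subsetI) (metis cov atLeastAtMost_iff)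
  moreover have "X \<inter> ?I \<noteq> {}" "Y \<inter> ?I \<noteq> {}" using ends \<open>t0 \<le> t1\<close> by force+
  ultimately have "X \<inter> Y \<inter> ?I \<noteq> {}"
    using assms(1,2) unfolding connected_closed by blast
  then show ?thesis using that by auto
qed

corollary common_point_on_vertical:
  assumes "closed X" "closed Y" "y0 \<le> y1" "\<And>y. y0 \<le> y \<Longrightarrow> y \<le> y1 \<Longrightarrow> pt x y \<in> X \<union> Y"
    "pt x y0 \<in> X" "pt x y1 \<in> Y"
  obtains y where "y0 \<le> y" "y \<le> y1" "pt x y \<in> X" "pt x y \<in> Y"
proof -
  have eq: "pt x y = pt x 0 + y *\<^sub>R pt 0 1" for y by (simp add: vec_eq_iff forall_2)
  show ?thesis
    by (rule common_point_on_line[of X Y y0 y1 "pt x 0" "pt 0 1", folded eq, OF assms that])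
qed

corollary common_point_on_horizontal:
  assumes "closed X" "closed Y" "x0 \<le> x1" "\<And>x. x0 \<le> x \<Longrightarrow> x \<le> x1 \<Longrightarrow> pt x y \<in> X \<union> Y"
    "pt x0 y \<in> X" "pt x1 y \<in> Y"
  obtains x where "x0 \<le> x" "x \<le> x1" "pt x y \<in> X" "pt x y \<in> Y"
proof -
  have eq: "pt x y = pt 0 y + x *\<^sub>R pt 1 0" for x by (simp add: vec_eq_iff forall_2)
  show ?thesis
    by (rule common_point_on_line[of X Y x0 x1 "pt 0 y" "pt 1 0", folded eq, OF assms that])
qed

section \<open>Right angles in a tilted unit square\<close>

definition \<sigma> :: real where "\<sigma> = sqrt phi"

lemma sigma_quartic: "\<sigma>^4 = \<sigma>^2 + 1"
proof -
  have "phi^2 = phi + 1" by (simp add: phi_def power2_eq_square field_simps)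
  moreover have "phi \<ge> 0" by (simp add: phi_def)
  then have "\<sigma>^2 = phi" by (simp add: \<sigma>_def)
  ultimately show ?thesis by (metis power_mult mult_2 numeral_Bit0 power_even_eq)
qed

lemma sigma_bounds: "1272/1000 < \<sigma>" "\<sigma> < 12721/10000"
proof -
  have "2.236 < sqrt 5" by (rule real_less_rsqrt) (simp add: power2_eq_square)
  then have a: "(1272/1000)^2 < phi" by (simp add: phi_def power2_eq_square)
  have "sqrt 5 < 2.2361" by (rule real_less_lsqrt) (simp_all add: power2_eq_square)
  then have b: "phi < (12721/10000)^2" by (simp add: phi_def power2_eq_square)
  show "1272/1000 < \<sigma>" unfolding \<sigma>_def using a by (rule real_less_rsqrt)
  show "\<sigma> < 12721/10000" unfolding \<sigma>_def by (rule real_less_lsqrt[OF _ b]) simp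
qed

lemma sigma_sq: "\<sigma>^2 * (\<sigma>^2 - 1) = 1"
  using sigma_quartic by (simp add: algebra_simps flip: power_add)

text \<open>The hypotheses say that a right angle with legs \<open>P\<close> and \<open>R\<close> fits into a unit square whose
  axes are tilted by the angle with cosine \<open>c\<close> and sine \<open>s\<close>. The longest possible \<open>R\<close> is
  \<open>P - P sqrt (P\<^sup>2 - 1)\<close>, attained at the extreme tilt \<open>c = 1 / P\<close>, and the assumption on
  \<open>L\<close> places \<open>L\<close> above this value without a square root.
  If \<open>R > L\<close>, eliminating \<open>s\<close> gives \<open>P\<^sup>2 (1 - c\<^sup>2) < (1 - L c)\<^sup>2\<close>; the difference
  of the two sides is a convex quadratic in \<open>c\<close>, negative at \<open>c = 0\<close> and at most \<open>0\<close>
  at \<open>c = 1 / P\<close>, a contradiction.\<close>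

lemma leg_bound:
  fixes P R L c s :: real
  assumes cs: "0 \<le> c" "0 \<le> s" "c^2 + s^2 = 1" and P: "1 < P" and L: "(P - L)^2 \<le> P^2 * (P^2 - 1)"
    and 1: "P * c \<le> 1" and 2: "P * s + R * c \<le> 1"
  shows "R \<le> L"
proof (rule ccontr)
  assume "\<not> R \<le> L"
  have "c \<noteq> 0" using cs 2 P by (auto simp: power2_eq_1_iff)
  then have c: "c > 0" using cs by simp
  have "L * c < R * c" using c \<open>\<not> R \<le> L\<close> by simp
  then have 3: "P * s < 1 - L * c" using 2 by simp
  have "0 \<le> P * s" using P cs by simp
  then have "(P * s)^2 < (1 - L*c)^2" using 3 by (intro power_strict_mono) auto
  moreover have "(P * s)^2 = P^2 * (1 - c^2)" using cs(3) by (simp add: power_mult_distrib flip: cs(3))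
  ultimately have q: "P^2 * (1 - c^2) < (1 - L*c)^2" by simp
  define t where "t = P * c"
  have t: "0 < t" "t \<le> 1" using 1 c P by (auto simp: t_def)
  have "P^2 * (P^2 * (1 - c^2)) < P^2 * (1 - L*c)^2"
    by (rule mult_strict_left_mono[OF q]) (use P in auto)
  then have "P^2 * (P^2 - t^2) < (P - L*t)^2"
    by (simp add: t_def power2_eq_square algebra_simps)
  moreover have "(P - L*t)^2 \<le> (1-t) * P^2 + t * (P-L)^2"
  proof -
    \<comment> \<open>convexity in \<open>t\<close>, between \<open>t = 0\<close> and \<open>t = 1\<close>\<close>
    have "(1-t) * P^2 + t * (P-L)^2 - (P - L*t)^2 = t*(1-t)*L^2"
      by (simp add: power2_eq_square algebra_simps)
    moreover have "t*(1-t)*L^2 \<ge> 0" using t by simp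
    ultimately show ?thesis by linarith
  qed
  moreover have "t * (P-L)^2 \<le> t * (P^2 * (P^2 - 1))" using L t by simp
  ultimately have "P^2 * (P^2 - t^2) < (1-t) * P^2 + t * (P^2 * (P^2 - 1))" by linarith
  then have "P^2 * (P^2 - t^2) < P^2 * ((1-t) + t * (P^2 - 1))" by (simp add: algebra_simps)
  then have "P^2 - t^2 < (1-t) + t*(P^2-1)" using P by simp
  then have "(1-t) * (P^2 - 1 + t) < 0" by (simp add: power2_eq_square algebra_simps)
  moreover have "P^2 > 1" using P by (simp add: one_less_power)
  ultimately show False using t by (smt (verit) mult_nonneg_nonneg)
qed

lemma inverse_sigma: "(1 / \<sigma>)^2 + (1 / \<sigma>)^4 = 1"
proof -
  have "\<sigma>^4 > 0" using sigma_bounds by simp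
  moreover have "\<sigma>^4 * ((1 / \<sigma>)^2 + (1 / \<sigma>)^4) = \<sigma>^2 + 1"
    using sigma_bounds by (simp add: distrib_left power_one_over power2_eq_square power4_eq_xxxx)
  ultimately show ?thesis using sigma_quartic by simp
qed

text \<open>For a leg of length \<open>\<sigma>\<close> the bound \<open>L = \<sigma> - 1\<close> is exact, because
  \<open>\<sigma>\<^sup>2 (\<sigma>\<^sup>2 - 1) = 1\<close>.\<close>

lemma leg_golden:
  fixes R c s :: real
  assumes cs: "0 \<le> c" "0 \<le> s" "c^2 + s^2 = 1"
    and 1: "\<sigma> * c \<le> 1" and 2: "\<sigma> * s + R * c \<le> 1"
  shows "R \<le> \<sigma> - 1"
  by (rule leg_bound[OF cs _ _ 1 2]) (use sigma_bounds sigma_sq in auto)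

text \<open>A line above the curve \<open>P - P sqrt (P\<^sup>2 - 1)\<close> through its left end \<open>(1, 1)\<close>.
  The chord from there to \<open>(\<sigma>, \<sigma> - 1)\<close> has slope about \<open>- 2.68\<close>; any slope between that and
  \<open>- 5/2\<close> would serve, the latter being what \<open>leg_long\<close> and \<open>base_bound\<close> consume together.\<close>

lemma leg_short:
  fixes P R c s :: real
  assumes cs: "0 \<le> c" "0 \<le> s" "c^2 + s^2 = 1"
    and P: "1 \<le> P" "P \<le> \<sigma>"
    and 1: "P * c \<le> 1" and 2: "P * s + R * c \<le> 1" and 3: "R * s \<le> 1"
  shows "R \<le> 1 - 13/5 * (P - 1)"
proof (cases "P = 1")
  case True
  show ?thesis
  proof (rule ccontr)
    assume "\<not> ?thesis"
    then have R: "R > 1" using True by simp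
    show False
    proof (cases "c = 0")
      case True then show False using cs 3 R by (auto simp: power2_eq_1_iff)
    next
      case False
      then have "c < R * c" using R cs by simp
      then have "s + c < 1" using 2 True by simp
      then have "(s+c)^2 < 1" using cs by (simp add: power_less_one_iff)
      then have "s*c < 0" using cs(3) by (simp add: power2_sum)
      then show False using cs(1,2) by (simp add: mult_less_0_iff)
    qed
  qed
next
  case False
  then have P1: "1 < P" using P by simp
  have P2: "P < 128/100" using P sigma_bounds by simp
  show ?thesis
  proof (rule leg_bound[OF cs P1 _ 1 2])
    have "P^2 * (P^2 - 1) - (P - (1 - 13/5 * (P-1)))^2 = (P-1) * (P^3 + P^2 - 12.96 * P + 12.96)"
      by (simp add: power2_eq_square power3_eq_cube field_simps)
    moreover have "P^3 + P^2 - 12.96 * P + 12.96 \<ge> 0"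
    proof -
      \<comment> \<open>tangents at \<open>1.28\<close>, just beyond \<open>\<sigma>\<close>, where the cubic is still positive\<close>
      have "P^3 \<ge> 3*1.28^2*P - 2*1.28^3"
      proof -
        have "(P - 1.28)^2 * (P + 2.56) \<ge> 0" using P1 by simp
        then show ?thesis by (simp add: power2_eq_square power3_eq_cube field_simps)
      qed
      moreover have "P^2 \<ge> 2*1.28*P - 1.28^2"
        using zero_le_power2[of "P - 1.28"] by (simp add: power2_eq_square field_simps)
      ultimately show ?thesis using P2 P1 by (simp add: power2_eq_square power3_eq_cube)
    qed
    ultimately show "(P - (1 - 13/5 * (P-1)))^2 \<le> P^2 * (P^2 - 1)"
      using P1 by (smt (verit) mult_nonneg_nonneg)
  qed
qed

text \<open>A line above the same curve through its right end \<open>(\<sigma>, \<sigma> - 1)\<close>. The slope is less steep than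
  that of the chord, at the price of being valid only for legs close to \<open>\<sigma>\<close>.\<close>

lemma leg_long:
  fixes R c s a :: real
  assumes cs: "0 \<le> c" "0 \<le> s" "c^2 + s^2 = 1"
    and a: "0 \<le> a" "a \<le> 153/1000"
    and 1: "(\<sigma> - a) * c \<le> 1" and 2: "(\<sigma> - a) * s + R * c \<le> 1"
  shows "R \<le> \<sigma> - 1 + 2 * a"
proof (rule leg_bound[OF cs _ _ 1 2])
  show "1 < \<sigma> - a" using a sigma_bounds by simp
  define K where "K = 6 + 2 * \<sigma> - 4 * \<sigma>^3 + (6 * \<sigma>^2 - 10)*a - 4 * \<sigma> * a^2 + a^3"
  have "(\<sigma>-a)^2 * ((\<sigma>-a)^2 - 1) - (\<sigma> - a - (\<sigma> - 1 + 2*a))^2 = (\<sigma>^4 - \<sigma>^2 - 1) + a * K"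
    by (simp add: power2_eq_square power3_eq_cube power4_eq_xxxx K_def algebra_simps)
  moreover have "K \<ge> 0"
  proof -
    have "\<sigma>^3 \<le> 20586/10000"
      using power_mono[of \<sigma> "12721/10000" 3] sigma_bounds by (simp add: power3_eq_cube)
    moreover have "\<sigma>^2 \<ge> (1272/1000)^2" using sigma_bounds by (intro power_mono) auto
    then have "(6 * \<sigma>^2 - 10)*a \<ge> (-3/10)*a" using a by (intro mult_right_mono) (auto simp: power2_eq_square)
    moreover have "\<sigma> * a^2 \<le> 13/10 * (a * (153/1000))"
      using sigma_bounds a unfolding power2_eq_square by (intro mult_mono) auto
    moreover have "a^3 \<ge> 0" using a by simp
    ultimately show ?thesis using a sigma_bounds unfolding K_def by simp
  qed
  ultimately show "(\<sigma> - a - (\<sigma> - 1 + 2*a))^2 \<le> (\<sigma>-a)^2 * ((\<sigma>-a)^2 - 1)"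
    using sigma_quartic a by (smt (verit) mult_nonneg_nonneg)
qed

text \<open>On the unit circle, from the point \<open>(1 / \<sigma>, 1 / \<sigma>\<^sup>2)\<close> towards smaller \<open>c\<close>, the function
  \<open>\<sigma> s + (\<sigma> - 1) c\<close> strictly increases at first and stays above its initial value \<open>1\<close>:
  a decrease of \<open>c\<close> is outweighed by the increase of \<open>s\<close> that it forces.\<close>

lemma leg_golden_unique:
  fixes c s :: real
  assumes cs: "0 \<le> c" "0 \<le> s" "c^2 + s^2 = 1"
    and 1: "\<sigma> * c \<le> 1" and 2: "\<sigma> * s + (\<sigma> - 1) * c \<le> 1"
  shows "c = 1 / \<sigma> \<and> s = 1 / \<sigma>^2"
proof -
  define r where "r = 1 / \<sigma>"
  have r: "0 < r" "r < 1" "\<sigma> * r = 1" using sigma_bounds by (auto simp: r_def)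
  have r4: "r^2 + r^4 = 1" using inverse_sigma by (simp add: r_def)
  have cr: "c \<le> r" using 1 sigma_bounds by (simp add: r_def field_simps)
  have "s^2 \<le> 1" using cs(3) by (smt (verit) zero_le_power2)
  then have s1: "s \<le> 1" using cs(2) by (simp add: power_le_one_iff)
  have "(r - c) * (r + c) - (s - r^2) * (s + r^2) = (r^2 + r^4) - (c^2 + s^2)"
    by algebra
  then have eq: "(r - c) * (r + c) = (s - r^2) * (s + r^2)" unfolding r4 cs(3) by simp
  have lin: "\<sigma> * (s - r^2) \<le> (\<sigma> - 1) * (r - c)"
  proof -
    have "\<sigma> * r^2 = r" using r by (simp add: power2_eq_square)
    then show ?thesis using 2 r(3) by (simp add: algebra_simps)
  qed
  have "c = r"
  proof (rule ccontr)
    assume "c \<noteq> r"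
    then have d: "r - c > 0" using cr by simp
    have "\<sigma> * ((r - c) * (r + c)) = \<sigma> * (s - r^2) * (s + r^2)" using eq by simp
    also have "\<dots> \<le> (\<sigma> - 1) * (r - c) * (s + r^2)" using lin cs by (intro mult_right_mono) auto
    finally have "(r-c) * (\<sigma> * (r + c)) \<le> (r-c) * ((\<sigma>-1) * (s + r^2))" by (simp add: algebra_simps)
    then have "\<sigma> * (r + c) \<le> (\<sigma>-1) * (s + r^2)" using d by simp
    moreover have "r^2 \<le> 1" using r by (simp add: power_le_one)
    then have "(\<sigma>-1) * (s + r^2) \<le> 3/10 * 2"
      using sigma_bounds s1 cs r by (intro mult_mono) auto
    moreover have "\<sigma> * c \<ge> 0" using sigma_bounds cs by simp
    ultimately show False using r by (simp add: algebra_simps)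
  qed
  moreover have "s = r^2"
  proof -
    have "s^2 = (r^2)^2" using r4 cs \<open>c = r\<close> by (simp flip: power_mult)
    then show ?thesis by (rule power2_eq_imp_eq) (use cs in auto)
  qed
  ultimately show ?thesis by (simp add: r_def power_divide)
qed

text \<open>The hypotheses say that a square tilted by \<open>(c, s)\<close> contains a segment of length \<open>\<sigma>\<close> and
  reaches \<open>a\<close> and \<open>b\<close> perpendicular to it at the two ends. The largest possible \<open>a\<close> and \<open>b\<close>
  trace a curve that starts, at the extreme tilt \<open>s = 1 / \<sigma>\<close>, in \<open>(0, \<sigma> - 1)\<close>, where its
  tangent is roughly \<open>a = 1.2 (\<sigma> - 1 - b)\<close>. The coefficient \<open>5/4\<close> puts a line through that
  point slightly above the tangent, and the second-order terms have the right sign.\<close>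

lemma base_bound:
  fixes a b c s :: real
  assumes cs: "0 < c" "0 \<le> s" "c^2 + s^2 = 1" and a: "0 \<le> a" "0 \<le> b"
    and 1: "\<sigma> * s + a * c \<le> 1" and 2: "\<sigma> * c + b * s \<le> 1"
  shows "4 * a + 5 * b \<le> 5 * (\<sigma> - 1)"
proof -
  have cos_le: "\<sigma> * c \<le> 1" using 2 a cs by (smt (verit) mult_nonneg_nonneg)
  have sin_le: "\<sigma> * s \<le> 1" using 1 a cs by (smt (verit) mult_nonneg_nonneg)
  have s0: "s > 0"
  proof (rule ccontr)
    assume "\<not> 0 < s" then have "s = 0" using cs by simp
    then show False using cs cos_le sigma_bounds by (auto simp: power2_eq_1_iff)
  qed
  define r where "r = 1 / \<sigma>"
  have r: "\<sigma> * r = 1" using sigma_bounds by (simp add: r_def)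
  have rb: "7861/10000 < r" "r < 7862/10000" using sigma_bounds by (auto simp: r_def field_simps)
  have r4: "r^2 + r^4 = 1" using inverse_sigma by (simp add: r_def)
  \<comment> \<open>deviation from the extreme tilt \<open>(r\<^sup>2, r)\<close>, at which \<open>a = 0\<close> and \<open>b = \<sigma> - 1\<close>\<close>
  define x y where "x = c - r^2" and "y = r - s"
  have y: "y \<ge> 0" using sin_le sigma_bounds by (simp add: y_def r_def field_simps)
  have "s^2 \<le> r^2" using y cs by (simp add: y_def)
  then have "c^2 \<ge> (r^2)^2" using r4 cs by (simp add: flip: power_mult)
  then have "r^2 \<le> c" by (rule power2_le_imp_le) (use cs(1) in simp)
  then have x: "x \<ge> 0" by (simp add: x_def)
  have "2*r*y - (2*r^2*x + x^2 + y^2) = (r^2 + r^4) - (c^2 + s^2)"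
    unfolding x_def y_def by algebra
  then have xy: "2*r*y = 2*r^2*x + x^2 + y^2" unfolding r4 cs(3) by simp
  \<comment> \<open>the claim multiplied by \<open>s c\<close>, with the largest \<open>a\<close> and \<open>b\<close> inserted, is \<open>h \<le> 0\<close>\<close>
  define h where "h = 4 * s + 5 * c - 4 * \<sigma> * s^2 - 5 * \<sigma> * c^2 - 5 * (\<sigma> - 1) * s * c"
  have "h = (4 * r + 5 * r^2 - 4 * (\<sigma> * r) * r - 5 * (\<sigma> * r) * r^3 - 5 * (\<sigma> * r) * r^2 + 5 * r^3)
      + (8 * (\<sigma> * r) + 5 * (\<sigma> * r) * r - 5 * r^2 - 4) * y + (5 - 10 * (\<sigma> * r) * r - 5 * (\<sigma> * r) + 5 * r) * x
      - 4 * \<sigma> * y^2 - 5 * \<sigma> * x^2 + 5 * (\<sigma> - 1) * (x * y)"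
    unfolding h_def x_def y_def by algebra
  then have h: "h = (4 + 5 * (r * (1 - r))) * y - 5 * r * x - 4 * \<sigma> * y^2 - 5 * \<sigma> * x^2 + 5 * (\<sigma> - 1) * (x * y)"
    unfolding r by algebra
  \<comment> \<open>the unit circle near the extreme tilt; its tangent there is \<open>y = r x\<close>\<close>
  have y_eq: "y = r * x + \<sigma> / 2 * (x^2 + y^2)"
  proof -
    have "\<sigma> * (2 * r * y) = \<sigma> * (2 * r^2 * x + x^2 + y^2)" using xy by simp
    then have "2 * (\<sigma> * r) * y = 2 * (\<sigma> * r) * r * x + \<sigma> * (x^2 + y^2)"
      by (simp add: algebra_simps power2_eq_square)
    then show ?thesis unfolding r by simp
  qed
  have "r * (1 - r) \<le> 7862/10000 * (2139/10000)" using rb by (intro mult_mono) auto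
  then have "(4 + 5 * (r * (1 - r))) * y \<le> 4841/1000 * y" using y by (intro mult_right_mono) auto
  also have "\<dots> = 4841/1000 * (r * x) + 4841/2000 * (\<sigma> * (x^2 + y^2))"
    by (subst y_eq) (simp add: algebra_simps)
  finally have 3: "(4 + 5 * (r * (1 - r))) * y \<le> 4841/1000 * (r * x) + 4841/2000 * (\<sigma> * x^2 + \<sigma> * y^2)"
    by (simp add: distrib_left)
  have 4: "r * x \<ge> 0" using x rb by simp
  have 5: "\<sigma> * x^2 \<ge> 1272/1000 * x^2" "\<sigma> * y^2 \<ge> 1272/1000 * y^2"
    by (rule mult_right_mono; use sigma_bounds in simp)+
  have 6: "(\<sigma> - 1) * (x * y) \<le> 3/10 * (x * y)" using sigma_bounds x y by (intro mult_right_mono) auto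
  have 7: "x * y \<le> (x^2 + y^2) / 2" using sum_squares_bound[of x y] by simp
  have "h \<le> 0"
  proof -
    have lin: "A - 5 * R - 4 * Y - 5 * X + 5 * Z \<le> 0"
      if "A \<le> 4841 / 1000 * R + 4841 / 2000 * (X + Y)" "0 \<le> R" "1272/1000 * u \<le> X" "1272/1000 * v \<le> Y"
        "Z \<le> 3/10 * z" "z \<le> (u + v) / 2" "0 \<le> u" "0 \<le> v" for A R X Y Z u v z :: real
      using that by argo
    show ?thesis using lin[OF 3 4 5 6 7] unfolding h by (simp only: mult.assoc zero_le_power2)
  qed
  have "4 * s * (a * c) \<le> 4 * s * (1 - \<sigma> * s)" using 1 s0 by (intro mult_left_mono) auto
  moreover have "5 * c * (b * s) \<le> 5 * c * (1 - \<sigma> * c)" using 2 cs by (intro mult_left_mono) auto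
  ultimately have "(s * c) * (4 * a + 5 * b) \<le> h + (s * c) * (5 * (\<sigma> - 1))"
    by (simp add: h_def algebra_simps power2_eq_square)
  then have "(s * c) * (4 * a + 5 * b) \<le> (s * c) * (5 * (\<sigma> - 1))" using \<open>h \<le> 0\<close> by simp
  then show ?thesis using s0 cs by simp
qed

section \<open>Covers of the boundary by two unit squares\<close>

lemma pt_mem_strips: "pt x y \<in> strips c s e h \<longleftrightarrow>
    e \<le> c * x + s * y \<and> c * x + s * y \<le> e + 1 \<and> h \<le> c * y - s * x \<and> c * y - s * x \<le> h + 1"
  by (auto simp: strips_def)

lemma unit_vector_sum:
  fixes c s :: real
  assumes "0 < c" "0 \<le> s" "c^2 + s^2 = 1"
  shows "1 \<le> c + s" and "c + s \<le> 1 \<Longrightarrow> c = 1 \<and> s = 0"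
proof -
  have sq: "(c + s)^2 = 1 + 2 * (s * c)" using assms(3) by (simp add: power2_sum)
  moreover have "0 \<le> s * c" using assms by simp
  ultimately have "1^2 \<le> (c + s)^2" by simp
  then show ge: "1 \<le> c + s" by (rule power2_le_imp_le) (use assms in simp)
  assume "c + s \<le> 1"
  with ge have "c + s = 1" by simp
  with sq have "s * c = 0" by simp
  with assms(1) \<open>c + s = 1\<close> show "c = 1 \<and> s = 0" by simp
qed

lemma strips_upright: "strips 1 0 e h = (+) (pt e h) ` axis_square 0 1"
proof
  show "(+) (pt e h) ` axis_square 0 1 \<subseteq> strips 1 0 e h"
    by (auto simp: strips_def mem_axis_square)
  show "strips 1 0 e h \<subseteq> (+) (pt e h) ` axis_square 0 1"
  proof
    fix z assume "z \<in> strips 1 0 e h"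
    then show "z \<in> (+) (pt e h) ` axis_square 0 1"
      by (intro image_eqI[of _ _ "z - pt e h"]) (auto simp: strips_def mem_axis_square)
  qed
qed

lemma strips_upright_axis_square: "strips 1 0 e e = axis_square e (e + 1)"
  by (auto simp: strips_def mem_axis_square)

lemma unit_square_with_diagonal:
  assumes "is_square 1 Q" "1 \<le> l" and diag: "pt 0 0 \<in> Q \<and> pt l l \<in> Q \<or> pt l 0 \<in> Q \<and> pt 0 l \<in> Q"
  shows "l = 1 \<and> Q = axis_square 0 1"
proof -
  obtain c s e h where cs: "0 < c" "0 \<le> s" "c^2 + s^2 = 1" and Q: "Q = strips c s e h"
    using unit_square_strips[OF assms(1)] .
  have "l * (c + s) \<le> 1" using diag by (auto simp: Q pt_mem_strips algebra_simps)
  moreover have "1 * (c + s) \<le> l * (c + s)" using assms(2) cs by (intro mult_right_mono) auto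
  ultimately have "c + s \<le> 1" by simp
  then have 1: "c = 1" "s = 0" using unit_vector_sum(2)[OF cs] by auto
  then have "l = 1" using \<open>l * (c + s) \<le> 1\<close> assms(2) by simp
  then have "e = 0" "h = 0" using diag 1 by (auto simp: Q pt_mem_strips)
  then show ?thesis using \<open>l = 1\<close> 1 strips_upright_axis_square[of 0] by (simp add: Q)
qed

text \<open>For \<open>x = y = y' = 0\<close> and \<open>x' = l\<close> the points are the ends of a side of length \<open>l\<close> and the
  points at height \<open>b\<close> and \<open>a\<close> on the adjacent sides; leaving them general serves the opposite
  side as well. The extents of \<open>Q\<close> along its axes give \<open>l c + b s \<le> 1\<close> and \<open>l s + a c \<le> 1\<close>.
  Adding \<open>c\<close> times the first to \<open>s\<close> times the second gives
  \<open>l + (a + b) s c \<le> c + s \<le> 1 + s c\<close>.\<close>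

lemma unit_square_with_trapezoid:
  assumes "is_square 1 Q" "1 \<le> l" "l \<le> a + b"
    and pts: "pt x y \<in> Q" "pt (x + l) (y + b) \<in> Q" "pt x' y' \<in> Q" "pt (x' - l) (y' + a) \<in> Q"
  shows "l = 1 \<and> is_translate Q (axis_square 0 1)"
proof -
  obtain c s e h where cs: "0 < c" "0 \<le> s" "c^2 + s^2 = 1" and Q: "Q = strips c s e h"
    using unit_square_strips[OF assms(1)] .
  have 1: "c * (l * c + b * s) \<le> c * 1"
    using pts cs by (intro mult_left_mono) (auto simp: Q pt_mem_strips algebra_simps)
  have 2: "s * (l * s + a * c) \<le> s * 1"
    using pts cs by (intro mult_left_mono) (auto simp: Q pt_mem_strips algebra_simps)
  have "l * (s * c) \<le> (a + b) * (s * c)" using assms(3) cs by (intro mult_right_mono) auto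
  moreover have "c * (l * c + b * s) + s * (l * s + a * c) = l * (c^2 + s^2) + (a + b) * (s * c)"
    by (simp add: algebra_simps power2_eq_square)
  ultimately have 3: "l * (1 + s * c) \<le> c + s" using 1 2 cs(3) by (simp add: algebra_simps)
  have lt: "c \<le> 1" "s \<le> 1" using cs by (smt (verit) power_le_one_iff zero_le_power2 one_power2 power2_le_imp_le)+
  then have 4: "(1 - c) * (1 - s) \<ge> 0" by simp
  have 5: "1 * (1 + s * c) \<le> l * (1 + s * c)" using assms(2) cs by (intro mult_right_mono) auto
  have "(l - 1) * (1 + s * c) = 0" using 3 4 5 by (simp add: algebra_simps)
  moreover have "1 + s * c > 0" using cs by (smt (verit) mult_nonneg_nonneg)
  ultimately have l: "l = 1" by simp
  then have "(1 - c) * (1 - s) = 0" using 3 4 by (simp add: algebra_simps)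
  then have "c = 1 \<and> s = 0" using cs by auto
  then show ?thesis using l unfolding Q is_translate_def by (metis strips_upright)
qed

definition transposition :: "real^2 \<Rightarrow> real^2" where "transposition z = pt (z$2) (z$1)"
definition mirror :: "real \<Rightarrow> real^2 \<Rightarrow> real^2" where "mirror l z = pt (l - z$1) (z$2)"

lemma dist_2: "dist (x::real^2) y = sqrt ((x$1 - y$1)^2 + (x$2 - y$2)^2)"
  by (simp add: dist_norm norm_eq_sqrt_inner inner_2 power2_eq_square)

lemma plane_isometry_transposition: "plane_isometry transposition"
  by (simp add: plane_isometry_def transposition_def dist_2 add.commute)

lemma plane_isometry_mirror: "plane_isometry (mirror l)"
  by (simp add: plane_isometry_def mirror_def dist_2 power2_commute)

lemma transposition_transposition [simp]: "transposition (transposition z) = z"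
  by (simp add: transposition_def)

lemma mirror_mirror [simp]: "mirror l (mirror l z) = z"
  by (simp add: mirror_def)

lemma transposition_image_iff [simp]: "pt x y \<in> transposition ` X \<longleftrightarrow> pt y x \<in> X"
  by (metis (no_types, lifting) transposition_def image_iff pt_nth transposition_transposition)

lemma mirror_image_iff [simp]: "pt x y \<in> mirror l ` X \<longleftrightarrow> pt (l - x) y \<in> X"
  by (metis (no_types, lifting) mirror_def image_iff pt_nth mirror_mirror)

lemma transposition_axis_square [simp]: "transposition ` axis_square a b = axis_square a b"
  by (rule set_eqI) (metis pt_eta transposition_image_iff mem_axis_square pt_nth)

lemma mirror_axis_square [simp]: "mirror l ` axis_square 0 l = axis_square 0 l"
proof (rule set_eqI)
  fix z show "z \<in> mirror l ` axis_square 0 l \<longleftrightarrow> z \<in> axis_square 0 l"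
    using mirror_image_iff[of "z$1" "z$2" l "axis_square 0 l"] by (auto simp: mem_axis_square)
qed

lemma two_squares_aligned:
  assumes XY: "is_square 1 X" "is_square 1 Y" and l: "1 \<le> l" and cov: "frontier (axis_square 0 l) \<subseteq> X \<union> Y"
    and pts: "pt 0 0 \<in> X" "pt l 0 \<in> X" "pt 0 l \<in> Y" "pt l l \<in> Y"
  shows "l = 1 \<and> (is_translate X (axis_square 0 1) \<or> is_translate Y (axis_square 0 1))"
proof -
  have fr: "pt x y \<in> X \<union> Y" if "(x = 0 \<or> x = l) \<and> 0 \<le> y \<and> y \<le> l" for x y
    by (rule subsetD[OF cov]) (use l that in \<open>auto simp: mem_frontier_axis_square\<close>)
  note cl = closed_unit_square[OF XY(1)] closed_unit_square[OF XY(2)]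
  obtain a where a: "0 \<le> a" "a \<le> l" "pt 0 a \<in> X" "pt 0 a \<in> Y"
    by (rule common_point_on_vertical[OF cl, of 0 l 0]) (use l pts fr in auto)
  obtain b where b: "0 \<le> b" "b \<le> l" "pt l b \<in> X" "pt l b \<in> Y"
    by (rule common_point_on_vertical[OF cl, of 0 l l]) (use l pts fr in auto)
  show ?thesis
  proof (cases "l \<le> a + b")
    case True
    then show ?thesis
      using unit_square_with_trapezoid[OF XY(1) l, of a b 0 0 l 0] a b pts by simp
  next
    case False
    then show ?thesis
      using unit_square_with_trapezoid[OF XY(2) l, of "l - b" "l - a" 0 a l b] a b pts by simp
  qed
qed

text \<open>If a square contains opposite corners it equals \<open>[0,1]\<^sup>2\<close>. Otherwise each square holds exactly
  two adjacent corners, and a transposition of the axes turns the left side into the bottom one.\<close>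

lemma two_squares_cover:
  assumes XY: "is_square 1 X" "is_square 1 Y" and l: "1 \<le> l" and cov: "frontier (axis_square 0 l) \<subseteq> X \<union> Y"
  shows "l = 1 \<and> (is_translate X (axis_square 0 1) \<or> is_translate Y (axis_square 0 1))"
proof -
  have fr: "pt 0 0 \<in> X \<union> Y" "pt l 0 \<in> X \<union> Y" "pt 0 l \<in> X \<union> Y" "pt l l \<in> X \<union> Y"
    by (rule subsetD[OF cov]; use l in \<open>simp add: mem_frontier_axis_square\<close>)+
  have refl: "is_translate A A" for A :: "(real^2) set"
    unfolding is_translate_def by (rule exI[of _ 0]) (simp add: image_def)
  have cov': "frontier (axis_square 0 l) \<subseteq> Y \<union> X" using cov by blast
  have tc: "frontier (axis_square 0 l) \<subseteq> transposition ` X \<union> transposition ` Y"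
    using image_mono[OF cov, of transposition]
    by (simp add: image_Un flip: frontier_isometry_image[OF plane_isometry_transposition])
  then have tc': "frontier (axis_square 0 l) \<subseteq> transposition ` Y \<union> transposition ` X" by blast
  note tXY = XY[THEN is_square_isometry_image[OF plane_isometry_transposition]]
  have tt: "is_translate A (axis_square 0 1)" if "is_translate (transposition ` A) (axis_square 0 1)" for A
    using is_translate_isometry_cancel[OF plane_isometry_transposition, of A "axis_square 0 1"] that by simp
  show ?thesis
  proof (cases "(pt 0 0 \<in> X \<and> pt l l \<in> X) \<or> (pt l 0 \<in> X \<and> pt 0 l \<in> X)
      \<or> (pt 0 0 \<in> Y \<and> pt l l \<in> Y) \<or> (pt l 0 \<in> Y \<and> pt 0 l \<in> Y)")
    case True
    then show ?thesis
      using unit_square_with_diagonal[OF XY(1) l] unit_square_with_diagonal[OF XY(2) l] refl by metis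
  next
    case False
    with fr consider "pt 0 0 \<in> X" "pt l 0 \<in> X" "pt 0 l \<in> Y" "pt l l \<in> Y"
      | "pt 0 0 \<in> Y" "pt l 0 \<in> Y" "pt 0 l \<in> X" "pt l l \<in> X"
      | "pt 0 0 \<in> X" "pt 0 l \<in> X" "pt l 0 \<in> Y" "pt l l \<in> Y"
      | "pt 0 0 \<in> Y" "pt 0 l \<in> Y" "pt l 0 \<in> X" "pt l l \<in> X" by blast
    then show ?thesis
    proof cases
      case 1 then show ?thesis using two_squares_aligned[OF XY l cov] by blast
    next
      case 2 then show ?thesis using two_squares_aligned[OF XY(2,1) l cov'] by blast
    next
      case 3 then show ?thesis using two_squares_aligned[OF tXY l tc] tt[of X] tt[of Y] by auto
    next
      case 4 then show ?thesis using two_squares_aligned[OF tXY(2,1) l tc'] tt[of X] tt[of Y] by auto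
    qed
  qed
qed

lemma boundary_cover_two:
  assumes l: "1 \<le> l" and S: "is_square l S" and Q: "unit_square_cover 2 Q (frontier S)"
  shows "l = 1 \<and> (\<exists>i<2. is_translate (Q i) S)"
proof -
  obtain f where f: "plane_isometry f" "f ` S = axis_square 0 l" using square_normal_position[OF S] .
  have two: "{..<2::nat} = {0, 1}" by auto
  have sq: "is_square 1 (Q 0)" "is_square 1 (Q 1)" and cov: "frontier S \<subseteq> Q 0 \<union> Q 1"
    using Q by (auto simp: unit_square_cover_def two)
  have "frontier (axis_square 0 l) \<subseteq> f ` Q 0 \<union> f ` Q 1"
    using image_mono[OF cov, of f] by (simp add: image_Un flip: f(2) frontier_isometry_image[OF f(1)])
  from two_squares_cover[OF sq[THEN is_square_isometry_image[OF f(1)]] l this]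
  have "l = 1" "is_translate (f ` Q 0) (f ` S) \<or> is_translate (f ` Q 1) (f ` S)" using f(2) by auto
  then show ?thesis using is_translate_isometry_cancel[OF f(1)] by (metis pos2 one_less_numeral_iff semiring_norm(76))
qed

section \<open>Covers of the boundary by three unit squares\<close>

lemma rot_axis_square: "rot t ` axis_square 0 1 = strips (cos t) (sin t) 0 0"
proof
  have id: "cos t * (cos t * x - sin t * y) + sin t * (sin t * x + cos t * y) = x"
    "cos t * (sin t * x + cos t * y) - sin t * (cos t * x - sin t * y) = y"
    "cos t * (cos t * x + sin t * y) - sin t * (cos t * y - sin t * x) = x"
    "sin t * (cos t * x + sin t * y) + cos t * (cos t * y - sin t * x) = y" for x y
    using sin_cos_squared_add[of t] by algebra+
  show "rot t ` axis_square 0 1 \<subseteq> strips (cos t) (sin t) 0 0"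
    unfolding rot_def strips_def by (auto simp only: mem_axis_square mem_Collect_eq vector_2 id atLeastAtMost_iff add_0)
  show "strips (cos t) (sin t) 0 0 \<subseteq> rot t ` axis_square 0 1"
  proof
    fix z assume z: "z \<in> strips (cos t) (sin t) 0 0"
    show "z \<in> rot t ` axis_square 0 1"
    proof (rule image_eqI)
      show "z = rot t (pt (cos t * z$1 + sin t * z$2) (cos t * z$2 - sin t * z$1))"
        by (simp add: rot_def vec_eq_iff forall_2 id)
      show "pt (cos t * z$1 + sin t * z$2) (cos t * z$2 - sin t * z$1) \<in> axis_square 0 1"
        using z by (auto simp: mem_axis_square strips_def)
    qed
  qed
qed

lemma cos_sin_golden: "cos (arccos (1 / \<sigma>)) = 1 / \<sigma>" "sin (arccos (1 / \<sigma>)) = 1 / \<sigma>^2"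
proof -
  have 1: "-1 \<le> 1 / \<sigma>" "1 / \<sigma> \<le> 1" using sigma_bounds by (auto simp: field_simps)
  show "cos (arccos (1 / \<sigma>)) = 1 / \<sigma>" using 1 by (rule cos_arccos)
  have "1 - (1 / \<sigma>)^2 = (1 / \<sigma>^2)^2" using inverse_sigma by (simp add: power_divide flip: power_mult)
  then show "sin (arccos (1 / \<sigma>)) = 1 / \<sigma>^2" using sin_arccos[OF 1] by simp
qed

definition golden_trio :: "(real^2) set \<Rightarrow> (real^2) set \<Rightarrow> (real^2) set \<Rightarrow> (real^2) set \<Rightarrow> bool" where
  "golden_trio S X Y Z \<longleftrightarrow> (\<exists>f. plane_isometry f \<and> f ` S = axis_square 0 \<sigma> \<and>
     {f ` X, f ` Y, f ` Z} = {axis_square (\<sigma> - 1) \<sigma>, rot (arccos (1 / \<sigma>)) ` axis_square 0 1,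
        rot (- arccos (1 / \<sigma>)) ` axis_square 0 1})"

lemma rot_golden: "rot (arccos (1 / \<sigma>)) ` axis_square 0 1 = strips (1 / \<sigma>) (1 / \<sigma>^2) 0 0"
  by (simp add: rot_axis_square cos_sin_golden)

text \<open>The rotation by the negative angle, described by the edge direction in the closed first quadrant as
  in \<open>unit_square_strips\<close>; this is the form in which \<open>golden_position\<close> finds the square.\<close>

lemma rot_minus_golden: "rot (- arccos (1 / \<sigma>)) ` axis_square 0 1 = strips (1 / \<sigma>^2) (1 / \<sigma>) 0 (-1)"
  by (auto simp: rot_axis_square cos_sin_golden strips_def)

lemma golden_trio_isometry:
  assumes "plane_isometry g" "golden_trio (g ` S) (g ` X) (g ` Y) (g ` Z)"
  shows "golden_trio S X Y Z"
proof -
  obtain f where f: "plane_isometry f" "f ` g ` S = axis_square 0 \<sigma>"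
     "{f ` g ` X, f ` g ` Y, f ` g ` Z} = {axis_square (\<sigma> - 1) \<sigma>, rot (arccos (1 / \<sigma>)) ` axis_square 0 1,
        rot (- arccos (1 / \<sigma>)) ` axis_square 0 1}"
    using assms(2) unfolding golden_trio_def by (elim exE conjE) (rule that)
  then show ?thesis unfolding golden_trio_def
    by (intro exI[of _ "f \<circ> g"]) (simp add: plane_isometry_compose assms(1) image_comp)
qed

text \<open>A square holding a whole side of length \<open>l \<ge> \<sigma>\<close> reaches at most \<open>\<sigma> - 1\<close> along the
  adjacent sides: that side and the reached segment are the legs of a right angle.\<close>

lemma leg_on_base:
  assumes "is_square 1 Q" "\<sigma> \<le> l" and "pt x0 y0 \<in> Q" "pt (x0 + l) y0 \<in> Q"
    and "pt x0 y \<in> Q \<or> pt (x0 + l) y \<in> Q"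
  shows "\<bar>y - y0\<bar> \<le> \<sigma> - 1"
proof -
  obtain c s e h where cs: "0 < c" "0 \<le> s" "c^2 + s^2 = 1" and Q: "Q = strips c s e h"
    using unit_square_strips[OF assms(1)] .
  have sc: "s^2 + c^2 = 1" using cs by simp
  have "l * c \<le> 1" "l * s \<le> 1" using assms(3,4) by (auto simp: Q pt_mem_strips algebra_simps)
  moreover have m: "\<sigma> * c \<le> l * c" "\<sigma> * s \<le> l * s" using assms(2) cs by (auto intro!: mult_right_mono)
  ultimately have 1: "\<sigma> * c \<le> 1" "\<sigma> * s \<le> 1" by auto
  have "(l * s + (y - y0) * c \<le> 1 \<and> l * c + (y0 - y) * s \<le> 1) \<or>
     (l * c + (y - y0) * s \<le> 1 \<and> l * s + (y0 - y) * c \<le> 1)"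
    using assms(3-5) by (auto simp: Q pt_mem_strips algebra_simps)
  then have "\<sigma> * s + (y - y0) * c \<le> 1 \<and> \<sigma> * c + (y0 - y) * s \<le> 1 \<or>
      \<sigma> * c + (y - y0) * s \<le> 1 \<and> \<sigma> * s + (y0 - y) * c \<le> 1" using m by linarith
  then have "y - y0 \<le> \<sigma> - 1 \<and> y0 - y \<le> \<sigma> - 1"
    using leg_golden[of c s] leg_golden[of s c] cs sc 1 by (meson less_imp_le)
  then show ?thesis by (simp add: abs_le_iff)
qed

lemma unit_square_diameter:
  assumes "is_square 1 Q" "pt x y \<in> Q" "pt x' y' \<in> Q"
  shows "(x - x')^2 + (y - y')^2 \<le> 2"
proof -
  obtain c s e h where cs: "0 < c" "0 \<le> s" "c^2 + s^2 = 1" and Q: "Q = strips c s e h"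
    using unit_square_strips[OF assms(1)] .
  have "\<bar>c * (x - x') + s * (y - y')\<bar> \<le> 1" "\<bar>c * (y - y') - s * (x - x')\<bar> \<le> 1"
    using assms(2,3) by (auto simp: Q pt_mem_strips algebra_simps)
  then have "(c * (x - x') + s * (y - y'))^2 \<le> 1" "(c * (y - y') - s * (x - x'))^2 \<le> 1"
    by (simp_all add: abs_square_le_1)
  moreover have "(c * (x - x') + s * (y - y'))^2 + (c * (y - y') - s * (x - x'))^2
     = (c^2 + s^2) * ((x - x')^2 + (y - y')^2)" by algebra
  ultimately show ?thesis using cs(3) by simp
qed

text \<open>Three such points span a triangle of area \<open>l\<^sup>2 / 2 > 1 / 2\<close>, more than fits into a unit square.
  In terms of extents this is again \<open>l (1 + s c) \<le> s + c\<close>.\<close>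

lemma no_base_and_opposite_side:
  assumes "is_square 1 Q" "1 < l" "pt 0 0 \<in> Q" "pt l 0 \<in> Q" "0 \<le> x" "x \<le> l"
  shows "pt x l \<notin> Q"
proof
  assume p: "pt x l \<in> Q"
  obtain c s e h where cs: "0 < c" "0 \<le> s" "c^2 + s^2 = 1" and Q: "Q = strips c s e h"
    using unit_square_strips[OF assms(1)] .
  have "c * x + s * l \<le> 1" "c * l + s * (l - x) \<le> 1"
    using assms(3,4) p by (auto simp: Q pt_mem_strips algebra_simps)
  then have "s * (c * x + s * l) \<le> s * 1" "c * (c * l + s * (l - x)) \<le> c * 1"
    using cs by (simp_all only: mult_left_mono less_imp_le)
  moreover have "s * (c * x + s * l) + c * (c * l + s * (l - x)) = l * (c^2 + s^2) + l * (s * c)"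
    by algebra
  ultimately have "l * (1 + s * c) \<le> s + c" using cs(3) by (simp add: algebra_simps)
  moreover have "1 * (1 + s * c) < l * (1 + s * c)"
    using assms(2) cs by (intro mult_strict_right_mono) (auto intro!: add_pos_nonneg)
  moreover have "c \<le> 1" "s \<le> 1" using cs by (smt (verit) power_le_one_iff zero_le_power2 one_power2 power2_le_imp_le)+
  then have "(1 - c) * (1 - s) \<ge> 0" by simp
  ultimately show False by (simp add: algebra_simps)
qed

text \<open>The heart of the three-square case, up to reflection. Replacing \<open>l\<close> by \<open>\<sigma>\<close> in the extents
  only weakens them, so the bounds proved for \<open>\<sigma>\<close> apply; they leave room for nothing but equality,
  and equality fixes tilts and offsets.\<close>

lemma golden_position:
  assumes XYZ: "is_square 1 X" "is_square 1 Y" "is_square 1 Z" and l: "\<sigma> \<le> l"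
    and X: "pt 0 0 \<in> X" "pt l 0 \<in> X" "pt 0 a \<in> X" "pt l b \<in> X"
    and Y: "pt l l \<in> Y" "pt l b \<in> Y" "pt m l \<in> Y"
    and Z: "pt 0 l \<in> Z" "pt 0 a \<in> Z" "pt m l \<in> Z"
    and ab: "0 \<le> a" "a \<le> b" and m: "0 \<le> m" "m \<le> l"
  shows "l = \<sigma> \<and> X = strips (1 / \<sigma>^2) (1 / \<sigma>) 0 (-1) \<and> Y = axis_square (\<sigma> - 1) \<sigma>
     \<and> Z = strips (1 / \<sigma>) (1 / \<sigma>^2) 0 0"
proof -
  obtain c1 s1 e1 h1 where cs1: "0 < c1" "0 \<le> s1" "c1^2 + s1^2 = 1" and X': "X = strips c1 s1 e1 h1"
    using unit_square_strips[OF XYZ(1)] .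
  obtain c2 s2 e2 h2 where cs2: "0 < c2" "0 \<le> s2" "c2^2 + s2^2 = 1" and Y': "Y = strips c2 s2 e2 h2"
    using unit_square_strips[OF XYZ(2)] .
  obtain c3 s3 e3 h3 where cs3: "0 < c3" "0 \<le> s3" "c3^2 + s3^2 = 1" and Z': "Z = strips c3 s3 e3 h3"
    using unit_square_strips[OF XYZ(3)] .
  have mono: "\<sigma> * t \<le> l * t" if "0 \<le> t" for t using l that by (rule mult_right_mono)
  have "l * s1 + a * c1 \<le> 1" "l * c1 + b * s1 \<le> 1"
    using X by (auto simp: X' pt_mem_strips algebra_simps)
  then have x: "\<sigma> * s1 + a * c1 \<le> 1" "\<sigma> * c1 + b * s1 \<le> 1"
    using mono[OF cs1(2)] mono[OF less_imp_le[OF cs1(1)]] by linarith+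
  have 1: "4 * a + 5 * b \<le> 5 * (\<sigma> - 1)"
    using base_bound[OF cs1 _ _ x] ab by simp
  have bl: "b \<le> \<sigma> - 1" and al: "a \<le> 153/1000" using 1 ab sigma_bounds by auto
  have "(l - b) * s2 \<le> 1" "(l - b) * c2 + (l - m) * s2 \<le> 1" "(l - m) * c2 \<le> 1"
    using Y by (auto simp: Y' pt_mem_strips algebra_simps)
  then have y: "(\<sigma> - b) * s2 \<le> 1" "(\<sigma> - b) * c2 + (l - m) * s2 \<le> 1" "(l - m) * c2 \<le> 1"
    using mono[OF cs2(2)] mono[OF less_imp_le[OF cs2(1)]] by (simp_all add: left_diff_distrib)
  have 2: "l - m \<le> 1 - 13/5 * (\<sigma> - b - 1)"
    using y by (intro leg_short[of s2 c2]) (use cs2 ab bl in auto)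
  have "(l - a) * c3 \<le> 1" "(l - a) * s3 + m * c3 \<le> 1"
    using Z by (auto simp: Z' pt_mem_strips algebra_simps)
  then have z: "(\<sigma> - a) * c3 \<le> 1" "(\<sigma> - a) * s3 + m * c3 \<le> 1"
    using mono[OF cs3(2)] mono[OF less_imp_le[OF cs3(1)]] by (simp_all add: left_diff_distrib)
  have 3: "m \<le> \<sigma> - 1 + 2 * a"
    using z by (intro leg_long[of c3 s3]) (use cs3 ab al in auto)
  \<comment> \<open>\<open>\<sigma> \<le> l = m + (l - m) \<le> \<sigma> - (\<sigma> - 1 - b) / 10\<close>\<close>
  have b: "b = \<sigma> - 1" using 1 2 3 l bl by argo
  have a: "a = 0" using 1 ab b by simp
  have ls: "l = \<sigma>" and ms: "m = \<sigma> - 1" using 2 3 l a b by auto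
  note val = a b ls ms
  have "s1^2 + c1^2 = 1" using cs1 by simp
  from leg_golden_unique[OF _ _ this] cs1 x
  have c1: "s1 = 1 / \<sigma>" "c1 = 1 / \<sigma>^2" unfolding val by auto
  have c3: "c3 = 1 / \<sigma>" "s3 = 1 / \<sigma>^2" using leg_golden_unique[OF _ _ cs3(3)] cs3 z unfolding val by auto
  have c2: "c2 = 1" "s2 = 0" using unit_vector_sum(2)[OF cs2] y unfolding val by auto
  \<comment> \<open>the known points have extent exactly \<open>1\<close> along the axes, which fixes the offsets\<close>
  have g: "(1 / \<sigma>) * \<sigma> = 1" "(1 / \<sigma>) * (\<sigma> - 1) + 1 / \<sigma>^2 * \<sigma> = 1"
    using sigma_bounds by (auto simp: power2_eq_square field_simps)
  have "e1 = 0" "h1 = -1" using X g unfolding X' pt_mem_strips c1 val by auto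
  moreover have "e3 = 0" "h3 = 0" using Z g unfolding Z' pt_mem_strips c3 val by auto
  moreover have "e2 = \<sigma> - 1" "h2 = \<sigma> - 1" using Y unfolding Y' pt_mem_strips c2 val by auto
  ultimately show ?thesis
    using ls c1 c2 c3 strips_upright_axis_square[of "\<sigma> - 1"] by (simp add: X' Y' Z')
qed

text \<open>The points that \<open>golden_position\<close> expects come from connectedness of the sides; the work is to
  exclude, on the relevant part of each side, the square that should not be there.\<close>

lemma base_in_first:
  assumes XYZ: "is_square 1 X" "is_square 1 Y" "is_square 1 Z" and l: "\<sigma> \<le> l"
    and cov: "frontier (axis_square 0 l) \<subseteq> X \<union> Y \<union> Z"
    and X: "pt 0 0 \<in> X" "pt l 0 \<in> X"
  shows "l = \<sigma> \<and> golden_trio (axis_square 0 l) X Y Z"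
proof -
  have l1: "1272/1000 < l" using sigma_bounds l by simp
  have lsq: "1.617 < l^2" using power_strict_mono[OF l1, of 2] by (simp add: power2_eq_square)
  have frv: "pt x y \<in> X \<union> Y \<union> Z" if "(x = 0 \<or> x = l) \<and> 0 \<le> y \<and> y \<le> l" for x y
    by (rule subsetD[OF cov]) (use l1 that in \<open>auto simp: mem_frontier_axis_square\<close>)
  have top: "pt x l \<in> Y \<union> Z" if "0 \<le> x" "x \<le> l" for x
  proof -
    have "pt x l \<in> X \<union> Y \<union> Z"
      by (rule subsetD[OF cov]) (use l1 that in \<open>auto simp: mem_frontier_axis_square\<close>)
    then show ?thesis using no_base_and_opposite_side[OF XYZ(1) _ X that] l1 by auto
  qed
  have low: "y \<le> \<sigma> - 1" if "pt 0 y \<in> X \<or> pt l y \<in> X" for y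
    using leg_on_base[OF XYZ(1) l, of 0 0 y] X that by simp
  \<comment> \<open>If \<open>V\<close> also held a whole side, \<open>W\<close> would contain \<open>(0, 0.3)\<close>
    and \<open>(l, l - 0.3)\<close>,
    since \<open>\<sigma> - 1 < 0.3\<close>; they are more than \<open>sqrt 2\<close> apart.\<close>
  have top2: False if V: "is_square 1 V" "is_square 1 W" "pt 0 l \<in> V" "pt l l \<in> V"
     and cov': "\<And>x y. x = 0 \<or> x = l \<Longrightarrow> 0 \<le> y \<Longrightarrow> y \<le> l \<Longrightarrow> pt x y \<in> X \<union> V \<union> W" for V W
  proof -
    have high: "\<bar>y - l\<bar> \<le> \<sigma> - 1" if "pt 0 y \<in> V \<or> pt l y \<in> V" for y
      using leg_on_base[OF V(1) l, of 0 l y] V that by simp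
    have mid: "pt x y \<in> W" if "x = 0 \<or> x = l" "3/10 \<le> y" "y \<le> l - 3/10" for x y
    proof (rule ccontr)
      assume "pt x y \<notin> W"
      then have "pt x y \<in> X \<or> pt x y \<in> V" using cov'[of x y] that by auto
      then show False using low[of y] high[of y] that sigma_bounds by auto
    qed
    have "pt 0 (3/10) \<in> W" "pt l (l - 3/10) \<in> W" using mid l1 by auto
    then have "(0 - l)^2 + (3/10 - (l - 3/10))^2 \<le> 2" by (rule unit_square_diameter[OF V(2)])
    moreover have "(672/1000)^2 \<le> (l - 6/10)^2" using l1 by (intro power_mono) auto
    moreover have "(3/10 - (l - 3/10))^2 = (l - 6/10)^2" by (simp add: power2_eq_square algebra_simps)
    ultimately show False using lsq by (simp add: power2_eq_square)
  qed
  have main: "l = \<sigma> \<and> golden_trio (axis_square 0 l) X V W"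
    if VW: "is_square 1 V" "is_square 1 W" and c: "pt l l \<in> V" "pt 0 l \<in> W"
     and side: "\<And>x y. x = 0 \<or> x = l \<Longrightarrow> 0 \<le> y \<Longrightarrow> y \<le> l \<Longrightarrow> pt x y \<in> X \<union> V \<union> W"
     and top': "\<And>x. 0 \<le> x \<Longrightarrow> x \<le> l \<Longrightarrow> pt x l \<in> V \<union> W" for V W
  proof -
    note cl = XYZ(1)[THEN closed_unit_square] VW[THEN closed_unit_square]
    \<comment> \<open>A square holding a top corner meets the vertical side away from that corner only
      above height \<open>0.6\<close>, and \<open>X\<close> reaches only \<open>\<sigma> - 1\<close>;
      so below that height two squares suffice.\<close>
    have far: "6/10 < y" if "is_square 1 U" "pt x l \<in> U" "pt x' y \<in> U" "(x - x')^2 = l^2" for U x x' y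
    proof (rule ccontr)
      assume "\<not> 6/10 < y"
      then have "(672/1000)^2 \<le> (l - y)^2" using l1 by (intro power_mono) auto
      moreover have "(x - x')^2 + (l - y)^2 \<le> 2" using that(1-3) by (rule unit_square_diameter)
      ultimately show False using that(4) lsq by (simp add: power2_eq_square)
    qed
    have left: "pt 0 y \<in> X \<union> W" if "0 \<le> y" "y \<le> 6/10" for y
      using side[of 0 y] far[OF VW(1) c(1), of 0 y] that l1 by auto
    have right: "pt l y \<in> X \<union> V" if "0 \<le> y" "y \<le> 6/10" for y
      using side[of l y] far[OF VW(2) c(2), of l y] that l1 by auto
    have "pt 0 (6/10) \<in> W" "pt l (6/10) \<in> V"
      using left[of "6/10"] right[of "6/10"] low[of "6/10"] sigma_bounds by auto
    obtain a where a: "0 \<le> a" "pt 0 a \<in> X" "pt 0 a \<in> W"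
      by (rule common_point_on_vertical[OF cl(1,3), of 0 "6/10" 0]) (use left X \<open>pt 0 (6/10) \<in> W\<close> in auto)
    obtain b where b: "0 \<le> b" "pt l b \<in> X" "pt l b \<in> V"
      by (rule common_point_on_vertical[OF cl(1,2), of 0 "6/10" l]) (use right X \<open>pt l (6/10) \<in> V\<close> in auto)
    have top'': "pt x l \<in> W \<union> V" if "0 \<le> x" "x \<le> l" for x using top' that by blast
    obtain m where m: "0 \<le> m" "m \<le> l" "pt m l \<in> W" "pt m l \<in> V"
      by (rule common_point_on_horizontal[OF cl(3,2), of 0 l l]) (use top'' l1 c in auto)
    show ?thesis
    proof (cases "a \<le> b")
      case True
      have *: "l = \<sigma> \<and> X = strips (1 / \<sigma>^2) (1 / \<sigma>) 0 (-1) \<and> V = axis_square (\<sigma> - 1) \<sigma>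
         \<and> W = strips (1 / \<sigma>) (1 / \<sigma>^2) 0 0"
        by (rule golden_position[OF XYZ(1) VW l X a(2) b(2) c(1) b(3) m(4) c(2) a(3) m(3) a(1) True m(1,2)])
      have "plane_isometry id" by (simp add: plane_isometry_def)
      with * show ?thesis unfolding golden_trio_def rot_golden rot_minus_golden
        by (intro conjI exI[of _ id]) auto
    next
      case False
      let ?f = "mirror l"
      note iso = plane_isometry_mirror[of l]
      note sq = XYZ(1) VW
      have *: "l = \<sigma> \<and> ?f ` X = strips (1 / \<sigma>^2) (1 / \<sigma>) 0 (-1) \<and> ?f ` W = axis_square (\<sigma> - 1) \<sigma>
         \<and> ?f ` V = strips (1 / \<sigma>) (1 / \<sigma>^2) 0 0"
        using a b c m X False l1
        by (intro golden_position[where l = l and a = b and b = a and m = "l - m"]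
            is_square_isometry_image[OF iso] sq l) auto
      with iso show ?thesis unfolding golden_trio_def rot_golden rot_minus_golden
        by (intro conjI exI[of _ ?f]) auto
    qed
  qed
  have tops: "pt 0 l \<in> Y \<union> Z" "pt l l \<in> Y \<union> Z" using top l1 by auto
  have "\<not> (pt 0 l \<in> Y \<and> pt l l \<in> Y)" using top2[OF XYZ(2,3)] frv by blast
  moreover have "\<not> (pt 0 l \<in> Z \<and> pt l l \<in> Z)" using top2[OF XYZ(3,2)] frv by blast
  ultimately consider "pt l l \<in> Y" "pt 0 l \<in> Z" | "pt l l \<in> Z" "pt 0 l \<in> Y" using tops by blast
  then show ?thesis
  proof cases
    case 1 show ?thesis by (rule main[OF XYZ(2,3) 1]) (use frv top in blast)+
  next
    case 2
    have "l = \<sigma> \<and> golden_trio (axis_square 0 l) X Z Y"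
      by (rule main[OF XYZ(3,2) 2]) (use frv top in blast)+
    then show ?thesis unfolding golden_trio_def insert_commute[of _ "_ ` Z"] by blast
  qed
qed

text \<open>Four corners in three squares: two corners share a square, and they are adjacent because no square contains
  opposite ones. A symmetry of the covered square moves their common side to the bottom.\<close>

lemma three_squares_cover:
  assumes XYZ: "is_square 1 X" "is_square 1 Y" "is_square 1 Z" and l: "\<sigma> \<le> l"
    and cov: "frontier (axis_square 0 l) \<subseteq> X \<union> Y \<union> Z"
  shows "l = \<sigma> \<and> golden_trio (axis_square 0 l) X Y Z"
proof -
  have bottom: "l = \<sigma> \<and> golden_trio (axis_square 0 l) A B C"
    if sq: "is_square 1 A" "is_square 1 B" "is_square 1 C" and cov: "frontier (axis_square 0 l) \<subseteq> A \<union> B \<union> C"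
      and p: "\<exists>U\<in>{A, B, C}. pt 0 0 \<in> U \<and> pt l 0 \<in> U" for A B C
  proof -
    have "l = \<sigma> \<and> golden_trio (axis_square 0 l) A B C" if "pt 0 0 \<in> A" "pt l 0 \<in> A"
      using base_in_first[OF sq l cov that] .
    moreover have "l = \<sigma> \<and> golden_trio (axis_square 0 l) B A C" if "pt 0 0 \<in> B" "pt l 0 \<in> B"
      by (rule base_in_first[OF sq(2,1,3) l _ that]) (use cov in blast)
    moreover have "l = \<sigma> \<and> golden_trio (axis_square 0 l) C A B" if "pt 0 0 \<in> C" "pt l 0 \<in> C"
      by (rule base_in_first[OF sq(3,1,2) l _ that]) (use cov in blast)
    ultimately show ?thesis using p by (auto simp: golden_trio_def insert_commute)
  qed
  have moved: "l = \<sigma> \<and> golden_trio (axis_square 0 l) X Y Z"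
    if g: "plane_isometry g" "g ` axis_square 0 l = axis_square 0 l"
      and p: "\<exists>U\<in>{X, Y, Z}. pt 0 0 \<in> g ` U \<and> pt l 0 \<in> g ` U" for g
  proof -
    have "frontier (axis_square 0 l) \<subseteq> g ` X \<union> g ` Y \<union> g ` Z"
      using image_mono[OF cov, of g] by (simp add: image_Un g(2) flip: frontier_isometry_image[OF g(1)])
    with XYZ[THEN is_square_isometry_image[OF g(1)]]
    have "l = \<sigma> \<and> golden_trio (axis_square 0 l) (g ` X) (g ` Y) (g ` Z)"
      by (rule bottom) (use p in auto)
    then show ?thesis using golden_trio_isometry[OF g(1), of "axis_square 0 l" X Y Z] unfolding g(2) by blast
  qed
  have l1: "1 < l" using sigma_bounds l by simp
  have fr: "pt 0 0 \<in> X \<union> Y \<union> Z" "pt l 0 \<in> X \<union> Y \<union> Z" "pt 0 l \<in> X \<union> Y \<union> Z" "pt l l \<in> X \<union> Y \<union> Z"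
    by (rule subsetD[OF cov]; use l1 in \<open>simp add: mem_frontier_axis_square\<close>)+
  have "\<not> (pt 0 0 \<in> U \<and> pt l l \<in> U)" "\<not> (pt l 0 \<in> U \<and> pt 0 l \<in> U)" if "U \<in> {X, Y, Z}" for U
    using unit_square_with_diagonal[of U l] l1 XYZ that by auto
  with fr have "\<exists>U\<in>{X, Y, Z}. pt 0 0 \<in> U \<and> pt l 0 \<in> U \<or> pt 0 0 \<in> U \<and> pt 0 l \<in> U \<or>
      pt l l \<in> U \<and> pt l 0 \<in> U \<or> pt l l \<in> U \<and> pt 0 l \<in> U"
    by (smt (verit) UnE insert_iff)
  then consider "\<exists>U\<in>{X, Y, Z}. pt 0 0 \<in> U \<and> pt l 0 \<in> U" | "\<exists>U\<in>{X, Y, Z}. pt 0 0 \<in> U \<and> pt 0 l \<in> U"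
    | "\<exists>U\<in>{X, Y, Z}. pt l l \<in> U \<and> pt l 0 \<in> U" | "\<exists>U\<in>{X, Y, Z}. pt l l \<in> U \<and> pt 0 l \<in> U" by blast
  then show ?thesis
  proof cases
    case 1 then show ?thesis by (rule bottom[OF XYZ cov])
  next
    case 2 then show ?thesis by (intro moved[OF plane_isometry_transposition]) auto
  next
    case 3
    have "plane_isometry (transposition \<circ> mirror l)"
      by (intro plane_isometry_compose plane_isometry_transposition plane_isometry_mirror)
    then show ?thesis by (rule moved) (unfold image_comp[symmetric], use 3 in auto)
  next
    case 4
    have "plane_isometry (transposition \<circ> mirror l \<circ> transposition)"
      by (intro plane_isometry_compose plane_isometry_transposition plane_isometry_mirror)
    then show ?thesis by (rule moved) (unfold image_comp[symmetric], use 4 in auto)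
  qed
qed

lemma boundary_cover_three:
  assumes l: "\<sigma> \<le> l" and S: "is_square l S" and Q: "unit_square_cover 3 Q (frontier S)"
  shows "l = \<sigma> \<and> golden_trio S (Q 0) (Q 1) (Q 2)"
proof -
  obtain f where f: "plane_isometry f" "f ` S = axis_square 0 l" using square_normal_position[OF S] .
  have three: "{..<3::nat} = {0, 1, 2}" by auto
  have sq: "is_square 1 (Q 0)" "is_square 1 (Q 1)" "is_square 1 (Q 2)" and cov: "frontier S \<subseteq> Q 0 \<union> Q 1 \<union> Q 2"
    using Q by (auto simp: unit_square_cover_def three)
  have "frontier (axis_square 0 l) \<subseteq> f ` Q 0 \<union> f ` Q 1 \<union> f ` Q 2"
    using image_mono[OF cov, of f] by (simp add: image_Un flip: f(2) frontier_isometry_image[OF f(1)])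
  from three_squares_cover[OF sq[THEN is_square_isometry_image[OF f(1)]] l this]
  show ?thesis using golden_trio_isometry[OF f(1), of S] by (simp flip: f(2))
qed

section \<open>Attainment and the theorem\<close>

lemma coverable_imp_bd_coverable: "coverable n l \<Longrightarrow> bd_coverable n l"
proof -
  assume "coverable n l"
  then obtain S Q where S: "is_square l S" "unit_square_cover n Q S" by (auto simp: coverable_def)
  obtain f where f: "plane_isometry f" "f ` S = axis_square 0 l" using square_normal_position[OF S(1)] .
  have "f ` frontier S \<subseteq> f ` S"
    by (simp add: f(2) axis_square_def frontier_subset_closed closed_cbox flip: frontier_isometry_image[OF f(1)])
  moreover have "inj f" using f(1) unfolding plane_isometry_def inj_def by (metis dist_eq_0_iff)
  ultimately have "frontier S \<subseteq> S" by (simp add: inj_image_subset_iff)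
  then show ?thesis using S unfolding bd_coverable_def unit_square_cover_def by blast
qed

lemma coverable_2_1: "coverable 2 1"
proof -
  have "is_square 1 (axis_square 0 1)" using is_square_axis_square[of 0 1] by simp
  moreover have "axis_square 0 1 \<subseteq> (\<Union>i<2::nat. axis_square 0 1)"
    by (intro UN_upper[of 0]) simp
  ultimately show ?thesis unfolding coverable_def unit_square_cover_def
    by (intro exI[of _ "axis_square 0 1"] exI[of _ "\<lambda>_. axis_square 0 1"]) simp
qed

text \<open>A point of \<open>[0,\<sigma>]\<^sup>2\<close> outside the upright square has a coordinate below \<open>\<sigma> - 1\<close>. It
  then satisfies the far edge inequality of one of the rotated squares, and, if it lies beyond the
  edge of that square through the origin, it lies in the other one.\<close>

lemma coverable_3_sigma: "coverable 3 \<sigma>"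
proof -
  have iso: "plane_isometry (rot t)" for t
  proof -
    have "(cos t * x - sin t * y - (cos t * x' - sin t * y'))^2 + (sin t * x + cos t * y - (sin t * x' + cos t * y'))^2
       = (x - x')^2 + (y - y')^2" for x y x' y'
      using sin_cos_squared_add[of t] by algebra
    then show ?thesis by (simp add: plane_isometry_def dist_2 rot_def)
  qed
  define Q where "Q i = (if i = 0 then axis_square (\<sigma> - 1) \<sigma> else if i = 1 then rot (arccos (1 / \<sigma>)) ` axis_square 0 1
     else rot (- arccos (1 / \<sigma>)) ` axis_square 0 1)" for i :: nat
  have three: "{..<3::nat} = {0, 1, 2}" by auto
  have "is_square 1 (axis_square 0 1)" "is_square 1 (axis_square (\<sigma> - 1) \<sigma>)"
    using is_square_axis_square[of 0 1] is_square_axis_square[of "\<sigma> - 1" \<sigma>] by simp_all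
  then have "is_square 1 (Q i)" for i
    by (simp add: Q_def is_square_isometry_image[OF iso])
  moreover have "axis_square 0 \<sigma> \<subseteq> (\<Union>i<3. Q i)"
  proof
    fix z assume z: "z \<in> axis_square 0 \<sigma>"
    define x y where "x = z$1" and "y = z$2"
    have xy: "0 \<le> x" "x \<le> \<sigma>" "0 \<le> y" "y \<le> \<sigma>" using z by (auto simp: mem_axis_square x_def y_def)
    have g: "0 < \<sigma>" "\<sigma> \<le> 2" "1 \<le> \<sigma>" using sigma_bounds by auto
    have W: "z \<in> Q 0 \<longleftrightarrow> \<sigma> - 1 \<le> x \<and> \<sigma> - 1 \<le> y" using xy by (auto simp: Q_def mem_axis_square x_def y_def)
    have inv: "1 / \<sigma> * u + 1 / \<sigma>^2 * v = (\<sigma> * u + v) / \<sigma>^2" "1 / \<sigma> * u - 1 / \<sigma>^2 * v = (\<sigma> * u - v) / \<sigma>^2"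
        "1 / \<sigma>^2 * v + 1 / \<sigma> * u = (\<sigma> * u + v) / \<sigma>^2" "1 / \<sigma>^2 * v - 1 / \<sigma> * u = (v - \<sigma> * u) / \<sigma>^2" for u v
      using g by (simp_all add: field_simps power2_eq_square)
    have div: "t / \<sigma>^2 \<le> 1 \<longleftrightarrow> t \<le> \<sigma>^2" "- 1 \<le> t / \<sigma>^2 \<longleftrightarrow> - t \<le> \<sigma>^2"
        "0 \<le> t / \<sigma>^2 \<longleftrightarrow> 0 \<le> t" "t / \<sigma>^2 \<le> 0 \<longleftrightarrow> t \<le> 0" for t
      using g by (auto simp: field_simps)
    have fits: "\<sigma> * u \<le> \<sigma>^2" if "u \<le> \<sigma>" for u
      using mult_left_mono[OF that, of \<sigma>] g by (simp add: power2_eq_square)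
    have R1: "z \<in> Q 1" if "\<sigma> * x + y \<le> \<sigma>^2" "x \<le> \<sigma> * y"
    proof -
      have "0 \<le> \<sigma> * x + y" using xy g by simp
      then have "z \<in> strips (1 / \<sigma>) (1 / \<sigma>^2) 0 0"
        using that xy fits[of y]
        unfolding strips_def mem_Collect_eq inv x_def[symmetric] y_def[symmetric] atLeastAtMost_iff add_0 div by linarith
      then show ?thesis by (simp add: Q_def rot_golden)
    qed
    have R2: "z \<in> Q 2" if "\<sigma> * y + x \<le> \<sigma>^2" "y \<le> \<sigma> * x"
    proof -
      have "0 \<le> \<sigma> * y + x" using xy g by simp
      then have "z \<in> strips (1 / \<sigma>^2) (1 / \<sigma>) 0 (-1)"
        using that xy fits[of x]
        unfolding strips_def mem_Collect_eq inv x_def[symmetric] y_def[symmetric] atLeastAtMost_iff add_0 add.left_inverse div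
        by linarith
      then show ?thesis by (simp add: Q_def rot_minus_golden)
    qed
    have sg2: "2 * (\<sigma> - 1) \<le> \<sigma>^2" using zero_le_power2[of "\<sigma> - 1"] by (simp add: power2_diff)
    have "z \<in> Q 0 \<or> z \<in> Q 1 \<or> z \<in> Q 2"
    proof -
      have *: "\<sigma> * u + v \<le> \<sigma>^2" if "u < \<sigma> - 1" "v \<le> \<sigma>" for u v
      proof -
        have "\<sigma> * u \<le> \<sigma> * (\<sigma> - 1)" using that g by (intro mult_left_mono) auto
        then show ?thesis using that by (simp add: power2_eq_square algebra_simps)
      qed
      have **: "u \<le> \<sigma> * v" if "\<sigma> * u < v" "0 \<le> u" for u v
      proof -
        have "u \<le> \<sigma> * u" using mult_right_mono[of 1 \<sigma> u] that g by simp
        moreover from this that have "v \<le> \<sigma> * v" using mult_right_mono[of 1 \<sigma> v] g by simp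
        ultimately show ?thesis using that by linarith
      qed
      consider "\<sigma> - 1 \<le> x \<and> \<sigma> - 1 \<le> y" | "x < \<sigma> - 1" | "y < \<sigma> - 1" by linarith
      then show ?thesis
      proof cases
        case 1 then show ?thesis using W by blast
      next
        case 2
        show ?thesis
        proof (cases "x \<le> \<sigma> * y")
          case True then show ?thesis using R1 *[OF 2 xy(4)] by blast
        next
          case False
          then show ?thesis using R2 **[OF _ xy(3)] 2 sg2 by auto
        qed
      next
        case 3
        show ?thesis
        proof (cases "y \<le> \<sigma> * x")
          case True then show ?thesis using R2 *[OF 3 xy(2)] by blast
        next
          case False
          then show ?thesis using R1 **[OF _ xy(1)] 3 sg2 by auto
        qed
      qed
    qed
    then show "z \<in> (\<Union>i<3. Q i)" unfolding three by blast
  qed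
  moreover have "is_square \<sigma> (axis_square 0 \<sigma>)" using is_square_axis_square[of 0 \<sigma>] sigma_bounds by simp
  ultimately show ?thesis
    unfolding coverable_def unit_square_cover_def by (intro exI[of _ "axis_square 0 \<sigma>"] exI[of _ Q]) simp
qed


theorem theorem1p2:
  shows "S_bd 2 = 1 \<and> S_full 2 = 1 \<and> S_bd 3 = sqrt phi \<and> S_full 3 = sqrt phi
    \<and> (\<forall>n\<in>{2,3}. is_largest (bd_coverable n) (S_bd n) \<and> is_largest (coverable n) (S_full n))
    \<and> (\<forall>n\<in>{2,3}. \<forall>S Q. is_square (S_bd n) S \<and> unit_square_cover n Q (frontier S) \<longrightarrow>
         (n = 2 \<longrightarrow> (\<exists>i<n. is_translate (Q i) S)) \<and>
         (n = 3 \<longrightarrow>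
            (let s = sqrt phi; \<alpha> = arccos (1 / sqrt phi) in
             \<exists>f. plane_isometry f \<and> f ` S = axis_square 0 s \<and>
               (\<lambda>i. f ` Q i) ` {..<n} =
                 {axis_square (s - 1) s, rot \<alpha> ` axis_square 0 1, rot (- \<alpha>) ` axis_square 0 1})))"
proof -
  have bd2: "y \<le> 1" if "bd_coverable 2 y" for y
    using that boundary_cover_two unfolding bd_coverable_def by (metis linear)
  have bd3: "y \<le> \<sigma>" if "bd_coverable 3 y" for y
    using that boundary_cover_three unfolding bd_coverable_def by (metis linear)
  have 2: "is_largest (bd_coverable 2) 1" "is_largest (coverable 2) 1"
    using coverable_2_1 bd2 coverable_imp_bd_coverable by (auto simp: is_largest_def)
  have 3: "is_largest (bd_coverable 3) \<sigma>" "is_largest (coverable 3) \<sigma>"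
    using coverable_3_sigma bd3 coverable_imp_bd_coverable by (auto simp: is_largest_def)
  have gr: "(GREATEST l. P l) = x" if "is_largest P x" for P and x :: real
    using that by (intro Greatest_equality) (auto simp: is_largest_def)
  have eq: "S_bd 2 = 1" "S_full 2 = 1" "S_bd 3 = \<sigma>" "S_full 3 = \<sigma>"
    using 2 3 by (auto simp: S_bd_def S_full_def gr)
  have u2: "\<exists>i<2. is_translate (Q i) S" if "is_square 1 S" "unit_square_cover 2 Q (frontier S)" for S Q
    using boundary_cover_two[OF _ that] by simp
  have three: "{..<3::nat} = {0, 1, 2}" by auto
  have u3: "\<exists>f. plane_isometry f \<and> f ` S = axis_square 0 \<sigma> \<and> (\<lambda>i. f ` Q i) ` {..<3} =
       {axis_square (\<sigma> - 1) \<sigma>, rot (arccos (1 / \<sigma>)) ` axis_square 0 1, rot (- arccos (1 / \<sigma>)) ` axis_square 0 1}"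
    if "is_square \<sigma> S" "unit_square_cover 3 Q (frontier S)" for S Q
    using boundary_cover_three[OF _ that] unfolding golden_trio_def three by simp
  show ?thesis unfolding \<sigma>_def[symmetric] Let_def using eq 2 3 u2 u3 by auto
qed

end
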